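(* Consider the three-stage EPIRK-$K$ method (defined in the context) with coefficients $$a_{1,1}=a_{2,1}=p_{1,1}=\tfrac{\sqrt3}{2},\qquad a_{2,2}=\tfrac34,\qquad b_1=\tfrac{2}{\sqrt3},\quad b_2=\tfrac{352}{729},\quad b_3=\tfrac{64}{729},$$ $$g_{1,1}=g_{2,1}=\tfrac34,\quad g_{2,2}=0,\quad g_{3,1}=1,\quad g_{3,2}=g_{3,3}=\tfrac9{16},$$ $$p_{2,1}=p_{2,2}=1,\qquad p_{3,1}=p_{3,2}=1,\quad p_{3,3}=0 .$$ If the Krylov-subspace dimension parameter satisfies $M\ge4$, this method has order four: for every $N$, every smooth $f:\mathbb{R}^N\to\mathbb{R}^N$ and every $y_n\in\mathbb{R}^N$, $y_{n+1}-y(t_n+h)=O(h^5)$ as $h\to0$, where $y$ solves $y'=f(y)$, $y(t_n)=y_n$. Moreover, the embedded method obtained by keeping all $a,g,p$ coefficients and replacing $(b_1,b_2,b_3)$ by $(\tfrac{2}{\sqrt3},\tfrac{32}{81},0)$ has order three, i.e. its one-step error is $O(h^4)$.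
   Context: Let $f:\mathbb{R}^N\to\mathbb{R}^N$ be smooth, $y_n\in\mathbb{R}^N$, $h>0$, $\mathbf{J}_n=f'(y_n)$ and $f_n=f(y_n)$. Given $M\ge1$, let $\mathcal{K}_M=\mathrm{span}\{f_n,\mathbf{J}_nf_n,\dots,\mathbf{J}_n^{M-1}f_n\}$, let $\mathbf{V}$ be a matrix whose columns form an orthonormal basis of $\mathcal{K}_M$, $\mathbf{H}=\mathbf{V}^T\mathbf{J}_n\mathbf{V}$, and $$\mathbf{A}_n=\mathbf{V}\mathbf{H}\mathbf{V}^T=\mathbf{V}\mathbf{V}^T\mathbf{J}_n\mathbf{V}\mathbf{V}^T .$$ For $k\ge1$, $\varphi_k(z)=\sum_{i\ge0}\frac{z^i}{(i+k)!}$ (applied to matrices as an entire function), and $\psi_j(z)=\sum_{k=1}^{j}p_{j,k}\varphi_k(z)$. Put $r(y)=f(y)-f(y_n)-\mathbf{A}_n(y-y_n)$. With $Y_0=y_n$, $\Delta^{(1)}r(Y_i)=r(Y_{i+1})-r(Y_i)$, $\Delta^{(j)}r(Y_i)=\Delta^{(j-1)}r(Y_{i+1})-\Delta^{(j-1)}r(Y_i)$, and $\Delta^{(j)}r(y_n)=\Delta^{(j)}r(Y_0)$. The three-stage EPIRK-$K$ method is the following scheme with this particular $\mathbf{A}_n$: $$Y_1=y_n+a_{1,1}\psi_1(g_{1,1}h\mathbf{A}_n)hf(y_n),$$ $$Y_2=y_n+a_{2,1}\psi_1(g_{2,1}h\mathbf{A}_n)hf(y_n)+a_{2,2}\psi_2(g_{2,2}h\mathbf{A}_n)h\Delta^{(1)}r(y_n),$$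 $$y_{n+1}=y_n+b_1\psi_1(g_{3,1}h\mathbf{A}_n)hf(y_n)+b_2\psi_2(g_{3,2}h\mathbf{A}_n)h\Delta^{(1)}r(y_n)+b_3\psi_3(g_{3,3}h\mathbf{A}_n)h\Delta^{(2)}r(y_n).$$ *)

theory Defs
  imports "HOL-Analysis.Analysis" "HOL-Library.Landau_Symbols"
begin

text \<open>Smooth means \<open>C\<^sup>\<infinity>\<close>: directional derivatives of every order exist as total
  derivatives and are continuous.\<close>

fun C_diff :: "nat \<Rightarrow> ('a::real_normed_vector \<Rightarrow> 'b::real_normed_vector) \<Rightarrow> bool" where
  "C_diff 0 f \<longleftrightarrow> continuous_on UNIV f"
| "C_diff (Suc k) f \<longleftrightarrow>
     (\<forall>x. f differentiable (at x)) \<and> (\<forall>v. C_diff k (\<lambda>x. frechet_derivative f (at x) v))"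

definition smooth :: "('a::real_normed_vector \<Rightarrow> 'b::real_normed_vector) \<Rightarrow> bool" where
  "smooth f \<longleftrightarrow> (\<forall>k. C_diff k f)"

text \<open>The library's multiplication (and hence power) on \<open>real ^ 'n ^ 'n\<close> is componentwise,
  so the matrix power is defined here through \<open>**\<close>.\<close>

primrec mpow :: "real ^ 'n ^ 'n \<Rightarrow> nat \<Rightarrow> real ^ 'n ^ 'n" where
  "mpow A 0 = mat 1"
| "mpow A (Suc i) = A ** mpow A i"

definition phi :: "nat \<Rightarrow> real ^ 'n ^ 'n \<Rightarrow> real ^ 'n ^ 'n" where
  "phi k A = (\<Sum>i. (1 / fact (i + k)) *\<^sub>R mpow A i)"

definition psi :: "(nat \<Rightarrow> nat \<Rightarrow> real) \<Rightarrow> nat \<Rightarrow> real ^ 'n ^ 'n \<Rightarrow> real ^ 'n ^ 'n" where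
  "psi p j A = (\<Sum>k=1..j. p j k *\<^sub>R phi k A)"

definition krylov_space :: "nat \<Rightarrow> real ^ 'n ^ 'n \<Rightarrow> real ^ 'n \<Rightarrow> (real ^ 'n) set" where
  "krylov_space M J v = span ((\<lambda>i. mpow J i *v v) ` {..<M})"

text \<open>The dimension of the Krylov space depends on the data (and may be \<open>0\<close>), so the matrix
  \<open>V\<close> is given by the list of its columns, and \<open>H = V\<^sup>T J V\<close> by its entries.\<close>

definition orthonormal_basis_of :: "(real ^ 'n) set \<Rightarrow> (real ^ 'n) list \<Rightarrow> bool" where
  "orthonormal_basis_of S V \<longleftrightarrow>
     (\<forall>i<length V. \<forall>j<length V. V ! i \<bullet> V ! j = (if i = j then 1 else 0)) \<and>
     span (set V) = S"

definition krylov_H :: "real ^ 'n ^ 'n \<Rightarrow> (real ^ 'n) list \<Rightarrow> nat \<Rightarrow> nat \<Rightarrow> real" where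
  "krylov_H J V i j = V ! i \<bullet> (J *v (V ! j))"

definition krylov_A :: "real ^ 'n ^ 'n \<Rightarrow> (real ^ 'n) list \<Rightarrow> real ^ 'n ^ 'n" where
  "krylov_A J V =
     (\<chi> r s. \<Sum>i<length V. \<Sum>j<length V. (V ! i) $ r * krylov_H J V i j * (V ! j) $ s)"

definition remainder ::
  "(real ^ 'n \<Rightarrow> real ^ 'n) \<Rightarrow> real ^ 'n ^ 'n \<Rightarrow> real ^ 'n \<Rightarrow> real ^ 'n \<Rightarrow> real ^ 'n" where
  "remainder f A yn y = f y - f yn - A *v (y - yn)"

text \<open>\<open>fdiff j r Y i\<close> is \<open>\<Delta>\<^sup>(\<^sup>j\<^sup>) r(Y\<^sub>i)\<close> for the list of nodes \<open>Y = [Y\<^sub>0, Y\<^sub>1, \<dots>]\<close>;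
  it only looks at the nodes \<open>Y\<^sub>i, \<dots>, Y\<^sub>i\<^sub>+\<^sub>j\<close>.\<close>

primrec fdiff :: "nat \<Rightarrow> ('a \<Rightarrow> 'b::ab_group_add) \<Rightarrow> 'a list \<Rightarrow> nat \<Rightarrow> 'b" where
  "fdiff 0 r Y i = r (Y ! i)"
| "fdiff (Suc j) r Y i = fdiff j r Y (Suc i) - fdiff j r Y i"

definition epirk_Y1 where
  "epirk_Y1 f A a g p yn h =
     yn + a 1 1 *\<^sub>R (psi p 1 ((g 1 1 * h) *\<^sub>R A) *v (h *\<^sub>R f yn))"
  for f :: "real ^ 'n \<Rightarrow> real ^ 'n" and a g p :: "nat \<Rightarrow> nat \<Rightarrow> real" and h :: real

definition epirk_Y2 where
  "epirk_Y2 f A a g p yn h =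
     (let r = remainder f A yn; Y = [yn, epirk_Y1 f A a g p yn h] in
        yn + a 2 1 *\<^sub>R (psi p 1 ((g 2 1 * h) *\<^sub>R A) *v (h *\<^sub>R f yn))
           + a 2 2 *\<^sub>R (psi p 2 ((g 2 2 * h) *\<^sub>R A) *v (h *\<^sub>R fdiff 1 r Y 0)))"
  for f :: "real ^ 'n \<Rightarrow> real ^ 'n" and a g p :: "nat \<Rightarrow> nat \<Rightarrow> real" and h :: real

definition epirk_step where
  "epirk_step f A a g p b yn h =
     (let r = remainder f A yn;
          Y = [yn, epirk_Y1 f A a g p yn h, epirk_Y2 f A a g p yn h] in
        yn + b 1 *\<^sub>R (psi p 1 ((g 3 1 * h) *\<^sub>R A) *v (h *\<^sub>R f yn))
           + b 2 *\<^sub>R (psi p 2 ((g 3 2 * h) *\<^sub>R A) *v (h *\<^sub>R fdiff 1 r Y 0))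
           + b 3 *\<^sub>R (psi p 3 ((g 3 3 * h) *\<^sub>R A) *v (h *\<^sub>R fdiff 2 r Y 0)))"
  for f :: "real ^ 'n \<Rightarrow> real ^ 'n" and a g p :: "nat \<Rightarrow> nat \<Rightarrow> real"
    and b :: "nat \<Rightarrow> real" and h :: real

text \<open>EPIRK-K: the scheme with \<open>A = V H V\<^sup>T\<close> built from the exact Jacobian at \<open>yn\<close>.\<close>

definition epirkK_step where
  "epirkK_step f V a g p b yn h =
     epirk_step f (krylov_A (jacobian f (at yn)) V) a g p b yn h"
  for f :: "real ^ 'n \<Rightarrow> real ^ 'n" and V :: "(real ^ 'n) list"

end

theory Submission
  imports Defs
begin

text \<open>
Write \<open>F = f yn\<close>, \<open>J\<close> for the Jacobian at \<open>yn\<close>, and \<open>N d = f (yn + d) - F - J *v d\<close>. The exact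
and the numerical solution are both expanded in powers of \<open>h\<close> up to an error of order five, and
the expansions are compared.

The only information on \<open>N\<close> that either side needs is its value along a curve that osculates
a rescaled flow: if \<open>d h = h c F + h\<^sup>2 (c\<^sup>2/2) J F + O(h\<^sup>3)\<close>, then
\<open>N (d h) = h\<^sup>2 c\<^sup>2 q2 + h\<^sup>3 c\<^sup>3 q3 + O(h\<^sup>4)\<close>, with two vectors \<open>q2\<close>, \<open>q3\<close> that do not depend on
\<open>c\<close> or \<open>d\<close> (\<open>nonlinear_part_expansion\<close>). The exact solution is such a curve with \<open>c = 1\<close>; the
displacements of both inner stages are such curves with \<open>c = 3/4\<close>. Hence the same \<open>q2\<close>, \<open>q3\<close>
occur on both sides. In addition to the terms of the linear flow \<open>exp (h J)\<close>, the exact solution contributes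
\<open>h\<^sup>3 q2/3 + h\<^sup>4 (J q2/12 + q3/4)\<close> (\<open>exact_solution_expansion\<close>).

The Krylov condition enters through \<open>krylov_powers_agree\<close>: \<open>A\<close> and \<open>J\<close> have the same powers on \<open>F\<close>
up to exponent \<open>M - 1 \<ge> 3\<close>, which is all that the linear flow sees up to \<open>h\<^sup>4\<close>. On \<open>q2\<close> the two
matrices may differ, and that difference is visible at \<open>h\<^sup>4\<close>: it enters the remainder at the second
stage through \<open>(J - A) q2\<close>, and \<open>A q2\<close> also comes from the linear term of \<open>\<psi>\<close>. For a weight vector
\<open>\<beta>\<close> with \<open>\<beta>\<^sub>1 = 2 / sqrt 3\<close> the local error is therefore, up to \<open>O(h\<^sup>5)\<close>, a combination of
\<open>q2\<close> at \<open>h\<^sup>3\<close> and of \<open>q3\<close>, \<open>J q2\<close>, \<open>A q2\<close> at \<open>h\<^sup>4\<close>, with coefficients affine in \<open>\<beta>\<^sub>2\<close> and \<open>\<beta>\<^sub>3\<close>. The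
given weights cancel all four coefficients; the embedded ones satisfy
\<open>\<beta>\<^sub>2 - \<beta>\<^sub>3 = 32/81\<close> as well, which cancels the \<open>h\<^sup>3\<close> coefficient.
\<close>

section \<open>Asymptotic orders at zero from the right\<close>

text \<open>Landau's \<open>u = O(h\<^sup>k)\<close> as \<open>h\<close> decreases to \<open>0\<close>, for vector-valued \<open>u\<close>.\<close>
definition has_order :: "nat \<Rightarrow> (real \<Rightarrow> 'a::real_normed_vector) \<Rightarrow> bool" where
  "has_order k u \<longleftrightarrow> (\<exists>C. \<forall>\<^sub>F h in at_right 0. norm (u h) \<le> C * h ^ k)"

lemma eventually_unit_at_right_0: "\<forall>\<^sub>F h::real in at_right 0. 0 < h \<and> h \<le> 1"
  unfolding eventually_at_right_field by (auto intro!: exI[of _ 1])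

lemma has_order_posE:
  assumes "has_order k u"
  obtains C where "C > 0" "\<forall>\<^sub>F h in at_right 0. norm (u h) \<le> C * h ^ k"
proof -
  obtain C where C: "\<forall>\<^sub>F h in at_right 0. norm (u h) \<le> C * h ^ k"
    using assms by (auto simp: has_order_def)
  have "\<forall>\<^sub>F h in at_right 0. norm (u h) \<le> (\<bar>C\<bar> + 1) * h ^ k"
    using C eventually_unit_at_right_0
  proof eventually_elim
    case (elim h)
    have "C * h ^ k \<le> (\<bar>C\<bar> + 1) * h ^ k" using elim by (intro mult_right_mono) auto
    with elim show ?case by linarith
  qed
  then show ?thesis by (intro that[of "\<bar>C\<bar> + 1"]) auto
qed

lemma has_order_bigo: "has_order k u \<Longrightarrow> (\<lambda>h. norm (u h)) \<in> O[at_right 0](\<lambda>h. h ^ k)"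
proof (elim has_order_posE)
  fix C assume C: "C > 0" "\<forall>\<^sub>F h in at_right 0. norm (u h) \<le> C * h ^ k"
  show ?thesis
  proof (rule bigoI)
    show "\<forall>\<^sub>F h in at_right 0. norm (norm (u h)) \<le> C * norm (h ^ k)"
      using C(2) eventually_unit_at_right_0 by eventually_elim auto
  qed
qed

lemma has_order_cong: "\<forall>\<^sub>F h in at_right 0. u h = v h \<Longrightarrow> has_order k u \<Longrightarrow> has_order k v"
  unfolding has_order_def by (elim exE, rule exI) (auto elim: eventually_elim2)

lemma has_order_eq: "has_order k u \<Longrightarrow> (\<And>h. u h = v h) \<Longrightarrow> has_order k v"
  by (simp add: has_order_def)

lemma has_order_add:
  assumes "has_order k u" "has_order k v"
  shows "has_order k (\<lambda>h. u h + v h)"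
proof -
  obtain C D where "\<forall>\<^sub>F h in at_right 0. norm (u h) \<le> C * h ^ k"
    "\<forall>\<^sub>F h in at_right 0. norm (v h) \<le> D * h ^ k"
    using assms by (auto simp: has_order_def)
  then have "\<forall>\<^sub>F h in at_right 0. norm (u h + v h) \<le> (C + D) * h ^ k"
    by eventually_elim (smt (verit) norm_triangle_ineq ring_class.ring_distribs(2))
  then show ?thesis by (auto simp: has_order_def)
qed

lemma has_order_uminus: "has_order k u \<Longrightarrow> has_order k (\<lambda>h. - u h)"
  by (simp add: has_order_def)

lemma has_order_diff: "has_order k u \<Longrightarrow> has_order k v \<Longrightarrow> has_order k (\<lambda>h. u h - v h)"
  using has_order_add[of k u "\<lambda>h. - v h"] by (simp add: has_order_uminus)

lemma has_order_zero: "has_order k (\<lambda>h. 0)"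
  unfolding has_order_def by (auto intro!: exI[of _ 0])

lemma has_order_sum: "(\<And>i. i \<in> S \<Longrightarrow> has_order k (u i)) \<Longrightarrow> has_order k (\<lambda>h. \<Sum>i\<in>S. u i h)"
  by (induction S rule: infinite_finite_induct) (auto intro: has_order_add has_order_zero)

lemma has_order_const: "has_order 0 (\<lambda>h. c)"
  unfolding has_order_def by (auto intro!: exI[of _ "norm c"])

lemma has_order_power: "has_order k (\<lambda>h. h ^ k)"
  unfolding has_order_def
  by (auto intro!: exI[of _ 1] eventually_mono[OF eventually_unit_at_right_0])

lemma has_order_mono:
  assumes "has_order k u" "j \<le> k"
  shows "has_order j u"
proof -
  obtain C where C: "C > 0" "\<forall>\<^sub>F h in at_right 0. norm (u h) \<le> C * h ^ k"
    using assms(1) by (rule has_order_posE)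
  have "\<forall>\<^sub>F h in at_right 0. norm (u h) \<le> C * h ^ j"
    using C(2) eventually_unit_at_right_0
  proof eventually_elim
    case (elim h)
    have "C * h ^ k \<le> C * h ^ j"
      using elim C(1) assms(2) by (intro mult_left_mono power_decreasing) auto
    with elim show ?case by linarith
  qed
  then show ?thesis by (auto simp: has_order_def)
qed

lemma has_order_bilinear:
  assumes "bounded_bilinear B" "has_order j u" "has_order k v"
  shows "has_order (j + k) (\<lambda>h. B (u h) (v h))"
proof -
  obtain K where K: "K > 0" "\<And>a b. norm (B a b) \<le> norm a * norm b * K"
    using bounded_bilinear.pos_bounded[OF assms(1)] by auto
  obtain C where C: "C > 0" "\<forall>\<^sub>F h in at_right 0. norm (u h) \<le> C * h ^ j"
    using assms(2) by (rule has_order_posE)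
  obtain D where D: "D > 0" "\<forall>\<^sub>F h in at_right 0. norm (v h) \<le> D * h ^ k"
    using assms(3) by (rule has_order_posE)
  have "\<forall>\<^sub>F h in at_right 0. norm (B (u h) (v h)) \<le> (C * D * K) * h ^ (j + k)"
    using C(2) D(2) eventually_unit_at_right_0
  proof eventually_elim
    case (elim h)
    have "norm (B (u h) (v h)) \<le> norm (u h) * norm (v h) * K" by (rule K)
    also have "\<dots> \<le> (C * h ^ j) * (D * h ^ k) * K"
      using elim C(1) D(1) K(1) by (intro mult_right_mono mult_mono) auto
    finally show ?case by (simp add: power_add mult_ac)
  qed
  then show ?thesis by (auto simp: has_order_def)
qed

lemma has_order_linear:
  assumes "bounded_linear L" "has_order k u"
  shows "has_order k (\<lambda>h. L (u h))"
proof -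
  have "bounded_bilinear (\<lambda>(a::real) b. a *\<^sub>R L b)"
    using bounded_bilinear.comp[OF bounded_bilinear_scaleR bounded_linear_ident assms(1)] .
  from has_order_bilinear[OF this has_order_const assms(2), of 1] show ?thesis by simp
qed

lemmas has_order_scaleR = has_order_bilinear[OF bounded_bilinear_scaleR]

lemma has_order_cscale: "has_order k u \<Longrightarrow> has_order k (\<lambda>h. (c::real) *\<^sub>R u h)"
  using has_order_scaleR[OF has_order_const, of k u c] by simp

lemma has_order_pscale: "has_order k u \<Longrightarrow> has_order (j + k) (\<lambda>h. h ^ j *\<^sub>R u h)"
  using has_order_scaleR[OF has_order_power] .

lemma has_order_monomial: "has_order k (\<lambda>h. h ^ k *\<^sub>R c)"
  using has_order_pscale[OF has_order_const, of k c] by simp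

lemma has_order_matrix: "has_order k u \<Longrightarrow> has_order k (\<lambda>h. (A::real^'n^'m) *v u h)"
  by (rule has_order_linear[OF matrix_vector_mul_bounded_linear])

lemma vector_derivative_increment_bound:
  fixes u :: "real \<Rightarrow> 'a::real_normed_vector"
  assumes "t \<ge> 0"
    and "\<And>s. s \<in> {0..t} \<Longrightarrow> (u has_vector_derivative u' s) (at s within {0..t})"
    and "\<And>s. s \<in> {0..t} \<Longrightarrow> norm (u' s) \<le> B"
  shows "norm (u t - u 0) \<le> B * t"
proof -
  have "norm (u t - u 0) \<le> B * norm (t - 0)"
  proof (rule differentiable_bound[where S = "{0..t}" and f' = "\<lambda>s r. r *\<^sub>R u' s"])
    show "onorm (\<lambda>r. r *\<^sub>R u' s) \<le> B" if "s \<in> {0..t}" for s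
    proof (rule onorm_le)
      show "norm (r *\<^sub>R u' s) \<le> B * norm r" for r
        using mult_left_mono[OF assms(3)[OF that], of "\<bar>r\<bar>"] by (simp add: mult.commute)
    qed
  qed (use assms in \<open>auto simp: has_vector_derivative_def\<close>)
  then show ?thesis using assms(1) by simp
qed

text \<open>The condition on \<open>e' 0\<close> is there because \<open>has_order\<close> says nothing about the value at \<open>0\<close>, while the
mean value inequality is applied on a closed interval from \<open>0\<close>; for \<open>k = 0\<close> that value is absorbed
into the constant.\<close>
lemma has_order_integrate:
  fixes e P :: "real \<Rightarrow> 'a::real_normed_vector"
  assumes "T > 0"
    and e: "\<And>t. t \<in> {0..T} \<Longrightarrow> (e has_vector_derivative e' t) (at t within {0..T})"
    and P: "\<And>t. (P has_vector_derivative P' t) (at t)"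
    and "e 0 = P 0" and "has_order k (\<lambda>h. e' h - P' h)" and "k > 0 \<Longrightarrow> e' 0 = P' 0"
  shows "has_order (Suc k) (\<lambda>h. e h - P h)"
proof -
  obtain C where C: "C > 0" "\<forall>\<^sub>F h in at_right 0. norm (e' h - P' h) \<le> C * h ^ k"
    using assms(5) by (rule has_order_posE)
  define D where "D = C + norm (e' 0 - P' 0)"
  obtain d where d: "d > 0" "\<And>h. 0 < h \<Longrightarrow> h < d \<Longrightarrow> norm (e' h - P' h) \<le> C * h ^ k"
    using C(2) unfolding eventually_at_right_field by auto
  have bound: "norm (e h - P h) \<le> D * h ^ Suc k" if h: "0 < h" "h < d" "h < T" for h
  proof -
    have "norm ((e h - P h) - (e 0 - P 0)) \<le> (D * h ^ k) * h"
    proof (rule vector_derivative_increment_bound)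
      fix s assume s: "s \<in> {0..h}"
      have "(e has_vector_derivative e' s) (at s within {0..h})"
        by (rule has_vector_derivative_within_subset[OF e]) (use s h in auto)
      then show "((\<lambda>h. e h - P h) has_vector_derivative (e' s - P' s)) (at s within {0..h})"
        by (intro has_vector_derivative_diff has_vector_derivative_at_within[OF P])
      show "norm (e' s - P' s) \<le> D * h ^ k"
      proof (cases "s = 0")
        case True
        then show ?thesis using assms(6) C(1) h by (cases "k = 0") (auto simp: D_def)
      next
        case False
        then have "norm (e' s - P' s) \<le> C * s ^ k" using d(2)[of s] s h by auto
        also have "\<dots> \<le> D * h ^ k"
          using s C(1) by (intro mult_mono power_mono) (auto simp: D_def)
        finally show ?thesis .
      qed
    qed (use h in auto)
    then show ?thesis using assms(4) by (simp add: mult_ac)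
  qed
  show ?thesis unfolding has_order_def eventually_at_right_field
    by (rule exI[of _ D], rule exI[of _ "min d T"]) (use bound d(1) assms(1) in auto)
qed

lemma has_order_eventually_small:
  assumes "has_order 1 e" "\<delta> > 0"
  shows "\<forall>\<^sub>F h in at_right 0. norm (e h) < \<delta>"
proof -
  obtain C where C: "\<forall>\<^sub>F h in at_right 0. norm (e h) \<le> C * h ^ 1"
    using assms(1) by (auto simp: has_order_def)
  have "((\<lambda>h::real. C * h ^ 1) \<longlongrightarrow> C * 0 ^ 1) (at_right 0)"
    by (intro tendsto_intros)
  then have "\<forall>\<^sub>F h in at_right 0. C * h ^ 1 < \<delta>"
    using assms(2) by (auto dest: order_tendstoD(2))
  with C show ?thesis by eventually_elim linarith
qed

lemma has_order_differentiable:
  assumes "g differentiable (at v)" "has_order 1 e"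
  shows "has_order 1 (\<lambda>h. g (v + e h) - g v)"
proof -
  obtain g' where g': "(g has_derivative g') (at v)"
    using assms(1) by (auto simp: differentiable_def)
  then have lin: "bounded_linear g'" by (rule has_derivative_bounded_linear)
  obtain d where d: "d > 0"
    "\<And>z. norm (z - v) < d \<Longrightarrow> norm (g z - g v - g' (z - v)) \<le> 1 * norm (z - v)"
    using g' unfolding has_derivative_at_alt by (meson zero_less_one)
  obtain C where C: "C > 0" "\<forall>\<^sub>F h in at_right 0. norm (e h) \<le> C * h ^ 1"
    using assms(2) by (rule has_order_posE)
  have "\<forall>\<^sub>F h in at_right 0. norm (g (v + e h) - g v - g' (e h)) \<le> C * h ^ 1"
    using has_order_eventually_small[OF assms(2) d(1)] C(2)
  proof eventually_elim
    case (elim h)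
    then show ?case using d(2)[of "v + e h"] by simp
  qed
  then have "has_order 1 (\<lambda>h. g (v + e h) - g v - g' (e h))" by (auto simp: has_order_def)
  from has_order_add[OF this has_order_linear[OF lin assms(2)]] show ?thesis by simp
qed

lemma has_order_divide:
  assumes "has_order (Suc k) u"
  shows "has_order k (\<lambda>h. (1 / h) *\<^sub>R u h)"
proof -
  obtain C where C: "\<forall>\<^sub>F h in at_right 0. norm (u h) \<le> C * h ^ Suc k"
    using assms by (auto simp: has_order_def)
  have "\<forall>\<^sub>F h in at_right 0. norm ((1 / h) *\<^sub>R u h) \<le> C * h ^ k"
    using C eventually_unit_at_right_0 by eventually_elim (auto simp: field_simps)
  then show ?thesis by (auto simp: has_order_def)
qed

text \<open>By homogeneity \<open>C (d h) = h ^ k *\<^sub>R C (d h / h)\<close>, and \<open>d h / h = v + O(h)\<close>.\<close>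
lemma has_order_homogeneous:
  assumes hom: "\<And>s v. C (s *\<^sub>R v) = s ^ k *\<^sub>R C v"
    and "C differentiable (at v)" "has_order 2 (\<lambda>h. d h - h *\<^sub>R v)"
  shows "has_order (k + 1) (\<lambda>h. C (d h) - h ^ k *\<^sub>R C v)"
proof -
  have "has_order 1 (\<lambda>h. (1 / h) *\<^sub>R (d h - h *\<^sub>R v))"
    using assms(3) by (intro has_order_divide) (simp add: numeral_2_eq_2)
  from has_order_pscale[OF has_order_differentiable[OF assms(2) this], of k]
  show ?thesis
  proof (rule has_order_cong[rotated])
    show "\<forall>\<^sub>F h in at_right 0. h ^ k *\<^sub>R (C (v + (1 / h) *\<^sub>R (d h - h *\<^sub>R v)) - C v)
        = C (d h) - h ^ k *\<^sub>R C v"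
      using eventually_unit_at_right_0
    proof eventually_elim
      case (elim h)
      have "h *\<^sub>R (v + (1 / h) *\<^sub>R (d h - h *\<^sub>R v)) = d h"
        using elim by (simp add: algebra_simps)
      with hom[of h "v + (1 / h) *\<^sub>R (d h - h *\<^sub>R v)"] show ?case
        by (simp add: scaleR_diff_right)
    qed
  qed
qed

section \<open>Taylor expansion of the vector field\<close>

text \<open>The homogeneous Taylor polynomial of degree \<open>k\<close> at \<open>x\<close>, as iterated directional derivatives
along the basis vectors. Peeling off the innermost derivative first matches the recursion of
\<open>C_diff\<close>, so that both can be unfolded together.\<close>
primrec taylor_term ::
  "nat \<Rightarrow> ('a::euclidean_space \<Rightarrow> 'b::real_normed_vector) \<Rightarrow> 'a \<Rightarrow> 'a \<Rightarrow> 'b" where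
  "taylor_term 0 f x d = f x"
| "taylor_term (Suc k) f x d =
     (\<Sum>i\<in>Basis. ((d \<bullet> i) / real (Suc k)) *\<^sub>R
        taylor_term k (\<lambda>x. frechet_derivative f (at x) i) x d)"

lemma taylor_term_scaleR: "taylor_term k f x (s *\<^sub>R d) = s ^ k *\<^sub>R taylor_term k f x d"
  by (induction k arbitrary: f) (auto simp: scaleR_sum_right intro!: sum.cong)

lemma taylor_term_differentiable: "taylor_term k f x differentiable (at d)"
proof (induction k arbitrary: f)
  case 0
  have "taylor_term 0 f x = (\<lambda>d. f x)" by (auto simp: fun_eq_iff)
  then show ?case by simp
next
  case (Suc k)
  have *: "taylor_term (Suc k) f x = (\<lambda>d. \<Sum>i\<in>Basis. ((d \<bullet> i) / real (Suc k)) *\<^sub>R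
        taylor_term k (\<lambda>x. frechet_derivative f (at x) i) x d)" by (auto simp: fun_eq_iff)
  have **: "(\<lambda>d. (d \<bullet> i) / real (Suc k)) differentiable (at d)" for i :: 'a
    unfolding divide_inverse
    by (intro bounded_linear_imp_differentiable bounded_linear_mult_const bounded_linear_inner_left)
  show ?case
    unfolding * by (intro differentiable_sum ballI differentiable_scaleR Suc ** finite_Basis)
qed

lemma taylor_term_1:
  assumes "f differentiable (at x)"
  shows "taylor_term 1 f x d = frechet_derivative f (at x) d"
proof -
  have "linear (frechet_derivative f (at x))"
    using assms linear_frechet_derivative by blast
  then have "frechet_derivative f (at x) (\<Sum>i\<in>Basis. (d \<bullet> i) *\<^sub>R i) =
    (\<Sum>i\<in>Basis. (d \<bullet> i) *\<^sub>R frechet_derivative f (at x) i)"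
    by (simp add: linear_sum linear_scale)
  then show ?thesis by (simp add: euclidean_representation)
qed

lemma C_diff_continuous:
  assumes "C_diff k f"
  shows "continuous_on UNIV f"
proof (cases k)
  case (Suc j)
  with assms have "f differentiable (at x)" for x by simp
  then show ?thesis
    by (auto intro: continuous_at_imp_continuous_on differentiable_imp_continuous_within)
qed (use assms in simp)

text \<open>Along the segment \<open>x + s d\<close> the \<open>s\<close>-derivative of the error of degree \<open>k + 1\<close> is a combination
of the errors of degree \<open>k\<close> of the partial derivatives of \<open>f\<close>, weighted by the coordinates of
\<open>d\<close>. Hence each integration gains one factor \<open>norm d\<close>, uniformly in the direction.\<close>
lemma taylor_bound:
  fixes f :: "'a::euclidean_space \<Rightarrow> 'b::real_normed_vector"
  assumes "C_diff k f"
  shows "\<exists>C. \<forall>d. norm d \<le> 1 \<longrightarrow>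
           norm (f (x + d) - (\<Sum>j<k. taylor_term j f x d)) \<le> C * norm d ^ k"
  using assms
proof (induction k arbitrary: f)
  case 0
  have "compact (f ` cball x 1)"
    by (intro compact_continuous_image continuous_on_subset[OF C_diff_continuous[OF 0]]) auto
  then obtain C where C: "\<And>z. z \<in> f ` cball x 1 \<Longrightarrow> norm z \<le> C"
    by (meson bounded_iff compact_imp_bounded)
  show ?case by (rule exI[of _ C]) (auto intro!: C simp: dist_norm)
next
  case (Suc k)
  let ?D = "\<lambda>i x. frechet_derivative f (at x) i"
  have diff: "f differentiable (at z)" for z using Suc.prems by simp
  have "\<forall>i. \<exists>C. \<forall>d. norm d \<le> 1 \<longrightarrow>
     norm (?D i (x + d) - (\<Sum>j<k. taylor_term j (?D i) x d)) \<le> C * norm d ^ k"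
    using Suc by auto
  then obtain C where C: "\<And>i d. norm d \<le> 1 \<Longrightarrow>
     norm (?D i (x + d) - (\<Sum>j<k. taylor_term j (?D i) x d)) \<le> C i * norm d ^ k"
    by metis
  have "norm (f (x + d) - (\<Sum>j<Suc k. taylor_term j f x d))
      \<le> (\<Sum>i\<in>Basis. \<bar>C i\<bar>) * norm d ^ Suc k" if d: "norm d \<le> 1" for d
  proof -
    define R where "R s = f (x + s *\<^sub>R d) - (\<Sum>j<Suc k. s ^ j *\<^sub>R taylor_term j f x d)" for s
    define R' where "R' s = (\<Sum>i\<in>Basis. (d \<bullet> i) *\<^sub>R
      (?D i (x + s *\<^sub>R d) - (\<Sum>j<k. taylor_term j (?D i) x (s *\<^sub>R d))))" for s
    have R'_eq: "R' s = frechet_derivative f (at (x + s *\<^sub>R d)) d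
        - (\<Sum>j<Suc k. (real j * s ^ (j - 1)) *\<^sub>R taylor_term j f x d)" for s
    proof -
      have "(\<Sum>j<Suc k. (real j * s ^ (j - 1)) *\<^sub>R taylor_term j f x d)
        = (\<Sum>j<k. \<Sum>i\<in>Basis. (d \<bullet> i) *\<^sub>R taylor_term j (?D i) x (s *\<^sub>R d))"
        unfolding sum.lessThan_Suc_shift taylor_term.simps(2) scaleR_sum_right
        by (simp add: taylor_term_scaleR mult.commute del: of_nat_Suc)
      also have "\<dots> = (\<Sum>i\<in>Basis. (d \<bullet> i) *\<^sub>R (\<Sum>j<k. taylor_term j (?D i) x (s *\<^sub>R d)))"
        by (subst sum.swap) (simp add: scaleR_sum_right)
      finally show ?thesis
        using taylor_term_1[OF diff, of "x + s *\<^sub>R d" d]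
        by (simp add: R'_def scaleR_diff_right sum_subtractf)
    qed
    have "norm (R 1 - R 0) \<le> ((\<Sum>i\<in>Basis. \<bar>C i\<bar>) * norm d ^ Suc k) * 1"
    proof (rule vector_derivative_increment_bound)
      fix s :: real assume s: "s \<in> {0..1}"
      have "((\<lambda>s. f (x + s *\<^sub>R d)) has_vector_derivative
          frechet_derivative f (at (x + s *\<^sub>R d)) d) (at s within {0..1})"
      proof -
        have "((f \<circ> (\<lambda>s. x + s *\<^sub>R d)) has_derivative
            (frechet_derivative f (at (x + s *\<^sub>R d)) \<circ> (\<lambda>r. r *\<^sub>R d))) (at s within {0..1})"
        proof (rule diff_chain_within)
          show "((\<lambda>s. x + s *\<^sub>R d) has_derivative (\<lambda>r. r *\<^sub>R d)) (at s within {0..1})"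
            by (auto intro!: derivative_eq_intros)
          show "(f has_derivative frechet_derivative f (at (x + s *\<^sub>R d)))
              (at (x + s *\<^sub>R d) within (\<lambda>s. x + s *\<^sub>R d) ` {0..1})"
            using diff by (simp add: frechet_derivative_works has_derivative_at_withinI)
        qed
        moreover have "linear (frechet_derivative f (at (x + s *\<^sub>R d)))"
          by (rule linear_frechet_derivative[OF diff])
        ultimately show ?thesis
          by (simp add: has_vector_derivative_def o_def linear_scale)
      qed
      then show "(R has_vector_derivative R' s) (at s within {0..1})"
        unfolding R_def R'_eq
      proof (intro has_vector_derivative_diff has_vector_derivative_sum)
        fix j
        have "((\<lambda>s. s ^ j) has_real_derivative real j * s ^ (j - 1)) (at s within {0..1})"
          by (auto intro!: derivative_eq_intros)
        from has_vector_derivative_scaleR[OF this has_vector_derivative_const]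
        show "((\<lambda>s. s ^ j *\<^sub>R taylor_term j f x d) has_vector_derivative
            (real j * s ^ (j - 1)) *\<^sub>R taylor_term j f x d) (at s within {0..1})" by simp
      qed
      have "norm (R' s) \<le> (\<Sum>i\<in>Basis. \<bar>C i\<bar> * norm d ^ Suc k)"
        unfolding R'_def
      proof (rule order_trans[OF norm_sum], rule sum_mono)
        fix i :: 'a assume i: "i \<in> Basis"
        have sd: "norm (s *\<^sub>R d) \<le> norm d" using s by (simp add: mult_left_le_one_le)
        have "norm (?D i (x + s *\<^sub>R d) - (\<Sum>j<k. taylor_term j (?D i) x (s *\<^sub>R d)))
            \<le> C i * norm (s *\<^sub>R d) ^ k" using sd d by (intro C) linarith
        also have "\<dots> \<le> \<bar>C i\<bar> * norm d ^ k"
          by (intro mult_mono power_mono sd) auto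
        finally have *: "norm (?D i (x + s *\<^sub>R d) - (\<Sum>j<k. taylor_term j (?D i) x (s *\<^sub>R d)))
            \<le> \<bar>C i\<bar> * norm d ^ k" .
        have "norm (d \<bullet> i) \<le> norm d" using i by (simp add: Basis_le_norm)
        from mult_mono[OF this *]
        show "norm ((d \<bullet> i) *\<^sub>R (?D i (x + s *\<^sub>R d) - (\<Sum>j<k. taylor_term j (?D i) x (s *\<^sub>R d))))
          \<le> \<bar>C i\<bar> * norm d ^ Suc k" by (simp add: mult_ac)
      qed
      then show "norm (R' s) \<le> (\<Sum>i\<in>Basis. \<bar>C i\<bar>) * norm d ^ Suc k"
        by (simp add: sum_distrib_right)
    qed auto
    moreover have "R 0 = 0"
      unfolding R_def sum.lessThan_Suc_shift by simp
    ultimately show ?thesis by (simp add: R_def)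
  qed
  then show ?case by blast
qed

lemma taylor_has_order:
  fixes f :: "'a::euclidean_space \<Rightarrow> 'b::real_normed_vector"
  assumes "C_diff k f" "has_order 1 d"
  shows "has_order k (\<lambda>h. f (x + d h) - (\<Sum>j<k. taylor_term j f x (d h)))"
proof -
  obtain K where K: "\<And>d. norm d \<le> 1 \<Longrightarrow>
      norm (f (x + d) - (\<Sum>j<k. taylor_term j f x d)) \<le> K * norm d ^ k"
    using taylor_bound[OF assms(1)] by blast
  obtain C where C: "C > 0" "\<forall>\<^sub>F h in at_right 0. norm (d h) \<le> C * h ^ 1"
    using assms(2) by (rule has_order_posE)
  have "\<forall>\<^sub>F h in at_right 0. norm (f (x + d h) - (\<Sum>j<k. taylor_term j f x (d h)))
      \<le> (\<bar>K\<bar> * C ^ k) * h ^ k"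
    using C(2) has_order_eventually_small[OF assms(2) zero_less_one] eventually_unit_at_right_0
  proof eventually_elim
    case (elim h)
    then have "norm (f (x + d h) - (\<Sum>j<k. taylor_term j f x (d h))) \<le> K * norm (d h) ^ k"
      by (intro K) simp
    also have "\<dots> \<le> \<bar>K\<bar> * (C * h) ^ k"
      using elim by (intro mult_mono power_mono) auto
    finally show ?case by (simp add: power_mult_distrib)
  qed
  then show ?thesis by (auto simp: has_order_def)
qed

lemma taylor_term_2_bilinear:
  fixes f :: "'a::euclidean_space \<Rightarrow> 'b::euclidean_space"
  obtains B where "bounded_bilinear B" "\<And>d. taylor_term 2 f x d = B d d"
proof
  define w where "w i j = frechet_derivative (\<lambda>x. frechet_derivative f (at x) i) (at x) j" for i j
  define B where "B u v = (\<Sum>i\<in>Basis. \<Sum>j\<in>Basis. ((u \<bullet> i) * (v \<bullet> j) / 2) *\<^sub>R w i j)" for u v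
  show "bounded_bilinear B"
    unfolding bilinear_conv_bounded_bilinear[symmetric] bilinear_def B_def
    by (auto intro!: linearI simp: inner_add_left algebra_simps add_divide_distrib
        sum.distrib scaleR_sum_right)
  show "taylor_term 2 f x d = B d d" for d
    unfolding numeral_2_eq_2 B_def w_def by (simp add: scaleR_sum_right)
qed

text \<open>The exponents of \<open>c\<close> are those of the flow slowed down by the factor \<open>c\<close>; this is what lets one
pair \<open>q2\<close>, \<open>q3\<close> serve the exact solution and the stages. With \<open>B d d\<close> and \<open>C d\<close> the Taylor terms
of degree two and three, \<open>q2 = B F F\<close> and \<open>q3 = (B F G + B G F) / 2 + C F\<close>.\<close>
lemma nonlinear_part_expansion:
  fixes f :: "'a::euclidean_space \<Rightarrow> 'b::euclidean_space" and x F G :: 'a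
  assumes f: "smooth f"
  defines "N \<equiv> \<lambda>d. f (x + d) - f x - frechet_derivative f (at x) d"
  obtains q2 q3 where
    "\<And>d. has_order 1 d \<Longrightarrow> has_order 2 (\<lambda>h. N (d h))"
    "\<And>d c. has_order 2 (\<lambda>h. d h - h *\<^sub>R c *\<^sub>R F) \<Longrightarrow> has_order 3 (\<lambda>h. N (d h) - h ^ 2 *\<^sub>R c ^ 2 *\<^sub>R q2)"
    "\<And>d c. has_order 3 (\<lambda>h. d h - (h *\<^sub>R c *\<^sub>R F + h ^ 2 *\<^sub>R (c ^ 2 / 2) *\<^sub>R G)) \<Longrightarrow>
       has_order 4 (\<lambda>h. N (d h) - (h ^ 2 *\<^sub>R c ^ 2 *\<^sub>R q2 + h ^ 3 *\<^sub>R c ^ 3 *\<^sub>R q3))"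
proof -
  obtain B where B: "bounded_bilinear B" "\<And>d. taylor_term 2 f x d = B d d"
    using taylor_term_2_bilinear[of f x] by blast
  interpret B: bounded_bilinear B by (rule B(1))
  define C where "C = taylor_term 3 f x"
  have Cd: "C_diff k f" for k using f by (simp add: smooth_def)
  have "f differentiable (at x)" using Cd[of 1] by simp
  note T1 = taylor_term_1[OF this]
  have first_terms: "sum t {..<2} = t 0 + t 1" "sum t {..<3} = t 0 + t 1 + t 2"
    "sum t {..<4} = t 0 + t 1 + t 2 + t 3" for t :: "nat \<Rightarrow> 'b"
    by (simp_all add: eval_nat_numeral)
  have rem: "has_order 2 (\<lambda>h. N (d h))" "has_order 3 (\<lambda>h. N (d h) - B (d h) (d h))"
    "has_order 4 (\<lambda>h. N (d h) - (B (d h) (d h) + C (d h)))" if "has_order 1 d" for d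
    using taylor_has_order[OF Cd that, of 2 x] taylor_has_order[OF Cd that, of 3 x] taylor_has_order[OF Cd that, of 4 x]
    unfolding first_terms T1 B(2) taylor_term.simps(1) C_def N_def by (simp_all add: diff_diff_eq add.assoc)
  have d1: "has_order 1 d" if "has_order 2 (\<lambda>h. d h - h *\<^sub>R v)" for d and v :: 'a
    using has_order_add[OF has_order_mono[OF that] has_order_monomial[of 1 v]] by simp
  have d2: "has_order 2 (\<lambda>h. d h - h *\<^sub>R v)" if "has_order 3 (\<lambda>h. d h - (h *\<^sub>R v + h ^ 2 *\<^sub>R w))" for d and v w :: 'a
    using has_order_add[OF has_order_mono[OF that] has_order_monomial[of 2 w]] by (simp add: algebra_simps)
  have Bdiff: "has_order (k + 1) (\<lambda>h. B (d h) (d h) - B (p h) (p h))"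
    if "has_order k (\<lambda>h. d h - p h)" "has_order 1 d" "has_order 1 p" for k d p
    using has_order_add[OF has_order_bilinear[OF B(1) that(1,2)] has_order_bilinear[OF B(1) that(3,1), unfolded add.commute[of 1]]]
    by (simp add: B.diff_left B.diff_right add.commute)
  have quad: "has_order 3 (\<lambda>h. B (d h) (d h) - h ^ 2 *\<^sub>R B v v)" if "has_order 2 (\<lambda>h. d h - h *\<^sub>R v)" for d v
    using Bdiff[OF that d1[OF that]] has_order_monomial[of 1 v]
    by (simp add: B.scaleR_left B.scaleR_right power2_eq_square)
  show ?thesis
  proof (rule that)
    show "has_order 2 (\<lambda>h. N (d h))" if "has_order 1 d" for d by (rule rem(1)[OF that])
    show "has_order 3 (\<lambda>h. N (d h) - h ^ 2 *\<^sub>R c ^ 2 *\<^sub>R B F F)"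
      if d: "has_order 2 (\<lambda>h. d h - h *\<^sub>R c *\<^sub>R F)" for d c
      using has_order_add[OF rem(2)[OF d1[OF d]] quad[OF d]]
      by (simp add: B.scaleR_left B.scaleR_right power2_eq_square)
    show "has_order 4 (\<lambda>h. N (d h) - (h ^ 2 *\<^sub>R c ^ 2 *\<^sub>R B F F
        + h ^ 3 *\<^sub>R c ^ 3 *\<^sub>R ((1/2) *\<^sub>R (B F G + B G F) + C F)))"
      if d: "has_order 3 (\<lambda>h. d h - (h *\<^sub>R c *\<^sub>R F + h ^ 2 *\<^sub>R (c ^ 2 / 2) *\<^sub>R G))" for d c
    proof -
      define w where "w = (c ^ 2 / 2) *\<^sub>R G"
      define p where "p h = h *\<^sub>R c *\<^sub>R F + h ^ 2 *\<^sub>R w" for h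
      have p: "has_order 1 p"
        unfolding p_def using has_order_add[OF has_order_monomial[of 1 "c *\<^sub>R F"] has_order_mono[OF has_order_monomial[of 2 w], of 1]]
        by (simp del: scaleR_scaleR)
      have "has_order 4 (\<lambda>h. B (d h) (d h) - B (p h) (p h))"
        using Bdiff[OF _ d1[OF d2[OF d]] p, of 3] d by (simp add: p_def w_def)
      moreover have "has_order 4 (\<lambda>h. C (d h) - h ^ 3 *\<^sub>R C (c *\<^sub>R F))"
        using has_order_homogeneous[of C 3, OF _ _ d2[OF d]]
        by (simp add: C_def taylor_term_scaleR taylor_term_differentiable)
      moreover note rem(3)[OF d1[OF d2[OF d]]] has_order_monomial[of 4 "B w w"]
      ultimately have "has_order 4 (\<lambda>h. (N (d h) - (B (d h) (d h) + C (d h)))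
        + (C (d h) - h ^ 3 *\<^sub>R C (c *\<^sub>R F)) + (B (d h) (d h) - B (p h) (p h)) + h ^ 4 *\<^sub>R B w w)"
        by (intro has_order_add)
      then show ?thesis
      proof (rule has_order_eq)
        fix h
        have "C (c *\<^sub>R F) = c ^ 3 *\<^sub>R C F" by (simp add: C_def taylor_term_scaleR)
        moreover have "B (p h) (p h) = h ^ 2 *\<^sub>R c ^ 2 *\<^sub>R B F F
          + h ^ 3 *\<^sub>R c ^ 3 *\<^sub>R (1/2) *\<^sub>R (B F G + B G F) + h ^ 4 *\<^sub>R B w w"
          by (simp add: p_def w_def B.add_left B.add_right B.scaleR_left B.scaleR_right
             eval_nat_numeral scaleR_add_right mult_ac)
        ultimately show "N (d h) - (B (d h) (d h) + C (d h))
          + (C (d h) - h ^ 3 *\<^sub>R C (c *\<^sub>R F)) + (B (d h) (d h) - B (p h) (p h)) + h ^ 4 *\<^sub>R B w w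
          = N (d h) - (h ^ 2 *\<^sub>R c ^ 2 *\<^sub>R B F F
            + h ^ 3 *\<^sub>R c ^ 3 *\<^sub>R ((1/2) *\<^sub>R (B F G + B G F) + C F))"
          by (simp add: scaleR_add_right)
      qed
    qed
  qed
qed

section \<open>Expansion of the exact solution\<close>

text \<open>Bootstrapping in \<open>e' = F + J e + N(e)\<close>: an expansion of \<open>e\<close> to order \<open>k\<close> gives one of the right-hand
side to order \<open>k\<close>, and integration gives \<open>e\<close> to order \<open>k + 1\<close>. The start \<open>e = O(h)\<close> is
differentiability at \<open>0\<close>.\<close>
lemma exact_solution_expansion:
  fixes e :: "real \<Rightarrow> real ^ 'n" and N :: "real ^ 'n \<Rightarrow> real ^ 'n" and J :: "real ^ 'n ^ 'n"
  assumes "T > 0" and e0: "e 0 = 0" and N0: "N 0 = 0"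
    and e: "\<And>t. t \<in> {0..T} \<Longrightarrow>
      (e has_vector_derivative (F + J *v e t + N (e t))) (at t within {0..T})"
    and N1: "\<And>d. has_order 1 d \<Longrightarrow> has_order 2 (\<lambda>h. N (d h))"
    and N2: "\<And>d c. has_order 2 (\<lambda>h. d h - h *\<^sub>R c *\<^sub>R F) \<Longrightarrow> has_order 3 (\<lambda>h. N (d h) - h ^ 2 *\<^sub>R c ^ 2 *\<^sub>R q2)"
    and N3: "\<And>d c. has_order 3 (\<lambda>h. d h - (h *\<^sub>R c *\<^sub>R F + h ^ 2 *\<^sub>R (c ^ 2 / 2) *\<^sub>R (J *v F))) \<Longrightarrow>
       has_order 4 (\<lambda>h. N (d h) - (h ^ 2 *\<^sub>R c ^ 2 *\<^sub>R q2 + h ^ 3 *\<^sub>R c ^ 3 *\<^sub>R q3))"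
  shows "has_order 5 (\<lambda>h. e h - (h *\<^sub>R F + h ^ 2 *\<^sub>R (1/2) *\<^sub>R (J *v F)
    + h ^ 3 *\<^sub>R ((1/6) *\<^sub>R (J *v (J *v F)) + (1/3) *\<^sub>R q2)
    + h ^ 4 *\<^sub>R ((1/24) *\<^sub>R (J *v (J *v (J *v F))) + (1/12) *\<^sub>R (J *v q2) + (1/4) *\<^sub>R q3)))"
proof -
  note J_simps = matrix_vector_right_distrib matrix_vector_mult_diff_distrib scaleR_matrix_vector_assoc[symmetric]
    matrix_vector_mult_scaleR
  have poly: "((\<lambda>t. t *\<^sub>R c1 + t ^ 2 *\<^sub>R c2 + t ^ 3 *\<^sub>R c3 + t ^ 4 *\<^sub>R c4) has_vector_derivative
      c1 + t *\<^sub>R 2 *\<^sub>R c2 + t ^ 2 *\<^sub>R 3 *\<^sub>R c3 + t ^ 3 *\<^sub>R 4 *\<^sub>R c4) (at t)"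
    for c1 c2 c3 c4 :: "real ^ 'n" and t
  proof -
    have mono: "((\<lambda>t. t ^ j *\<^sub>R c) has_vector_derivative (real j * t ^ (j - 1)) *\<^sub>R c) (at t)"
      for j and c :: "real ^ 'n"
    proof -
      have "((\<lambda>t. t ^ j) has_real_derivative real j * t ^ (j - 1)) (at t)"
        by (auto intro!: derivative_eq_intros)
      from has_vector_derivative_scaleR[OF this has_vector_derivative_const] show ?thesis by simp
    qed
    have "((\<lambda>t. t ^ 1 *\<^sub>R c1 + t ^ 2 *\<^sub>R c2 + t ^ 3 *\<^sub>R c3 + t ^ 4 *\<^sub>R c4) has_vector_derivative
      ((real 1 * t ^ (1 - 1)) *\<^sub>R c1 + (real 2 * t ^ (2 - 1)) *\<^sub>R c2 + (real 3 * t ^ (3 - 1)) *\<^sub>R c3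
       + (real 4 * t ^ (4 - 1)) *\<^sub>R c4)) (at t)"
      by (intro has_vector_derivative_add mono)
    then show ?thesis by (simp add: mult.commute)
  qed
  have step: "has_order (Suc k) (\<lambda>h. e h - (h *\<^sub>R F + h ^ 2 *\<^sub>R c2 + h ^ 3 *\<^sub>R c3 + h ^ 4 *\<^sub>R c4))"
    if "has_order k (\<lambda>h. (J *v e h + N (e h)) - (h *\<^sub>R 2 *\<^sub>R c2 + h ^ 2 *\<^sub>R 3 *\<^sub>R c3 + h ^ 3 *\<^sub>R 4 *\<^sub>R c4))"
    for k c2 c3 c4
    by (rule has_order_integrate[OF assms(1) e poly]) (use that in \<open>simp_all add: e0 N0 algebra_simps\<close>)
  have E1: "has_order 1 e"
  proof -
    have "(e has_derivative (\<lambda>t. t *\<^sub>R F)) (at 0 within {0..T})"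
      using e[of 0] assms(1) by (simp add: has_vector_derivative_def e0 N0)
    then obtain d where d: "d > 0"
      "\<And>t. t \<in> {0..T} \<Longrightarrow> norm (t - 0) < d \<Longrightarrow> norm (e t - e 0 - (t - 0) *\<^sub>R F) \<le> 1 * norm (t - 0)"
      unfolding has_derivative_within_alt by (meson zero_less_one)
    then have "norm (e h - h *\<^sub>R F) \<le> 1 * h ^ 1" if "0 < h" "h < min d T" for h
      using d(2)[of h] that by (simp add: e0)
    then have "has_order 1 (\<lambda>h. e h - h *\<^sub>R F)"
      unfolding has_order_def eventually_at_right_field
      by (intro exI[of _ 1] exI[of _ "min d T"]) (use d(1) assms(1) in auto)
    from has_order_add[OF this has_order_monomial[of 1 F]] show ?thesis by simp
  qed
  have E2: "has_order 2 (\<lambda>h. e h - h *\<^sub>R F)"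
    using step[of 1 0 0 0] has_order_add[OF has_order_matrix[OF E1] has_order_mono[OF N1[OF E1]]] by (simp add: numeral_2_eq_2)
  have NE2: "has_order 3 (\<lambda>h. N (e h) - h ^ 2 *\<^sub>R q2)"
    using N2[of e 1] E2 by simp
  have "has_order 2 (\<lambda>h. J *v (e h - h *\<^sub>R F) + ((N (e h) - h ^ 2 *\<^sub>R q2) + h ^ 2 *\<^sub>R q2))"
    by (intro has_order_add has_order_matrix E2 has_order_mono[OF NE2] has_order_monomial) simp
  with step[of 2 "(1/2) *\<^sub>R (J *v F)" 0 0]
  have E3: "has_order 3 (\<lambda>h. e h - (h *\<^sub>R F + h ^ 2 *\<^sub>R (1/2) *\<^sub>R (J *v F)))"
    by (simp add: J_simps algebra_simps)
  have NE3: "has_order 4 (\<lambda>h. N (e h) - (h ^ 2 *\<^sub>R q2 + h ^ 3 *\<^sub>R q3))"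
    using N3[of e 1] E3 by simp
  have "has_order 3 (\<lambda>h. J *v (e h - (h *\<^sub>R F + h ^ 2 *\<^sub>R (1/2) *\<^sub>R (J *v F))) + (N (e h) - h ^ 2 *\<^sub>R q2))"
    by (intro has_order_add has_order_matrix E3 NE2)
  with step[of 3 "(1/2) *\<^sub>R (J *v F)" "(1/6) *\<^sub>R (J *v (J *v F)) + (1/3) *\<^sub>R q2" 0]
  have "has_order 4 (\<lambda>h. e h - (h *\<^sub>R F + h ^ 2 *\<^sub>R (1/2) *\<^sub>R (J *v F)
    + h ^ 3 *\<^sub>R ((1/6) *\<^sub>R (J *v (J *v F)) + (1/3) *\<^sub>R q2)))"
    by (simp add: J_simps algebra_simps)
  then have "has_order 4 (\<lambda>h. J *v (e h - (h *\<^sub>R F + h ^ 2 *\<^sub>R (1/2) *\<^sub>R (J *v F)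
    + h ^ 3 *\<^sub>R ((1/6) *\<^sub>R (J *v (J *v F)) + (1/3) *\<^sub>R q2))) + (N (e h) - (h ^ 2 *\<^sub>R q2 + h ^ 3 *\<^sub>R q3)))"
    by (intro has_order_add has_order_matrix NE3)
  with step[of 4 "(1/2) *\<^sub>R (J *v F)" "(1/6) *\<^sub>R (J *v (J *v F)) + (1/3) *\<^sub>R q2"
      "(1/24) *\<^sub>R (J *v (J *v (J *v F))) + (1/12) *\<^sub>R (J *v q2) + (1/4) *\<^sub>R q3"]
  show ?thesis
    by (simp add: J_simps algebra_simps)
qed

section \<open>Matrix functions\<close>

lemma mpow_scaleR: "mpow (c *\<^sub>R A) i = c ^ i *\<^sub>R mpow A i"
  by (induction i) (simp_all add: scalar_matrix_assoc[symmetric] matrix_scalar_ac)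

lemma bounded_bilinear_matrix_mult:
  "bounded_bilinear ((**) :: real ^ 'n ^ 'n \<Rightarrow> real ^ 'n ^ 'n \<Rightarrow> real ^ 'n ^ 'n)"
  unfolding bilinear_conv_bounded_bilinear[symmetric] bilinear_def
proof (intro conjI allI linearI)
  fix A A' B :: "real ^ 'n ^ 'n"
  show "(A + A') ** B = A ** B + A' ** B"
    by (simp add: vec_eq_iff matrix_matrix_mult_def distrib_right sum.distrib)
qed (simp_all add: matrix_add_ldistrib scalar_matrix_assoc[symmetric] matrix_scalar_ac)

lemma bounded_bilinear_matrix_vector_mult:
  "bounded_bilinear ((*v) :: real ^ 'n ^ 'n \<Rightarrow> real ^ 'n \<Rightarrow> real ^ 'n)"
  unfolding bilinear_conv_bounded_bilinear[symmetric] bilinear_def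
  by (intro conjI allI linearI)
    (simp_all add: matrix_vector_mult_add_rdistrib matrix_vector_right_distrib
      scaleR_matrix_vector_assoc matrix_vector_mult_scaleR)

lemma mpow_bound:
  fixes A :: "real ^ 'n ^ 'n"
  obtains c K where "\<And>i. norm (mpow A i) \<le> c * K ^ i" "c \<ge> 0" "K \<ge> 0"
proof -
  obtain L where L: "L > 0" "\<And>(A :: real ^ 'n ^ 'n) (B :: real ^ 'n ^ 'n). norm (A ** B) \<le> norm A * norm B * L"
    using bounded_bilinear.pos_bounded[OF bounded_bilinear_matrix_mult[where 'n = 'n]] by auto
  define c where "c = norm (mat 1 :: real ^ 'n ^ 'n)"
  have "norm (mpow A i) \<le> c * (L * norm A) ^ i" for i
  proof (induction i)
    case (Suc i)
    have "norm (mpow A (Suc i)) \<le> norm A * norm (mpow A i) * L" using L(2) by simp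
    also have "\<dots> \<le> norm A * (c * (L * norm A) ^ i) * L"
      using Suc L(1) by (intro mult_right_mono mult_left_mono) auto
    finally show ?case by (simp add: mult_ac)
  qed (simp add: c_def)
  then show ?thesis using L(1) by (intro that[of c "L * norm A"]) (auto simp: c_def)
qed

text \<open>For \<open>h \<le> 1\<close> the tail from index \<open>m\<close> on has the factor \<open>h ^ m\<close>, and what remains is dominated by
a convergent exponential series independent of \<open>h\<close>.\<close>
lemma phi_expansion:
  fixes A :: "real ^ 'n ^ 'n"
  shows "has_order m (\<lambda>h. phi k (h *\<^sub>R A) - (\<Sum>i<m. h ^ i *\<^sub>R (1 / fact (i + k)) *\<^sub>R mpow A i))"
proof -
  obtain c K where K: "\<And>i. norm (mpow A i) \<le> c * K ^ i" "c \<ge> 0" "K \<ge> 0"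
    using mpow_bound[of A] by blast
  define b where "b i = c * (K ^ i / fact i)" for i
  have "summable b"
    unfolding b_def using summable_exp[of K] by (intro summable_mult) (simp add: field_simps)
  have term_le: "norm ((1 / fact (i + k)) *\<^sub>R mpow (h *\<^sub>R A) i) \<le> h ^ i * b i" if "0 < h" for h i
  proof -
    have "norm ((1 / fact (i + k)) *\<^sub>R mpow (h *\<^sub>R A) i) = h ^ i * ((1 / fact (i + k)) * norm (mpow A i))"
      using that by (simp only: mpow_scaleR norm_scaleR) simp
    also have "\<dots> \<le> h ^ i * ((1 / fact i) * (c * K ^ i))"
      using that K by (intro mult_left_mono mult_mono divide_left_mono fact_mono) auto
    finally show ?thesis by (simp add: b_def)
  qed
  have "norm (phi k (h *\<^sub>R A) - (\<Sum>i<m. h ^ i *\<^sub>R (1 / fact (i + k)) *\<^sub>R mpow A i))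
      \<le> (\<Sum>i. b (i + m)) * h ^ m" if h: "0 < h" "h \<le> 1" for h
  proof -
    let ?t = "\<lambda>i. (1 / fact (i + k)) *\<^sub>R mpow (h *\<^sub>R A) i"
    have b0: "0 \<le> b i" for i using K by (simp add: b_def)
    have "norm (?t i) \<le> b i" for i
    proof -
      have "h ^ i * b i \<le> 1 * b i" using h b0 by (intro mult_right_mono power_le_one) auto
      with term_le[OF h(1), of i] show ?thesis by linarith
    qed
    then have "summable ?t" using \<open>summable b\<close> by (rule summable_comparison_test'[rotated])
    from suminf_minus_initial_segment[OF this, of m]
    have "phi k (h *\<^sub>R A) - (\<Sum>i<m. ?t i) = (\<Sum>i. ?t (i + m))"
      by (simp add: phi_def)
    moreover have "norm (\<Sum>i. ?t (i + m)) \<le> (\<Sum>i. h ^ m * b (i + m))"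
    proof (rule norm_suminf_le)
      fix i
      have "h ^ (i + m) * b (i + m) \<le> h ^ m * b (i + m)"
        using h b0 by (intro mult_right_mono power_decreasing) auto
      with term_le[OF h(1), of "i + m"] show "norm (?t (i + m)) \<le> h ^ m * b (i + m)" by linarith
      show "summable (\<lambda>i. h ^ m * b (i + m))"
        using \<open>summable b\<close> by (intro summable_mult) (simp add: summable_iff_shift)
    qed
    moreover have "(\<Sum>i. h ^ m * b (i + m)) = (\<Sum>i. b (i + m)) * h ^ m"
      using \<open>summable b\<close> by (subst suminf_mult) (simp_all add: summable_iff_shift)
    moreover have "(\<Sum>i<m. ?t i) = (\<Sum>i<m. h ^ i *\<^sub>R (1 / fact (i + k)) *\<^sub>R mpow A i)"
      by (simp add: mpow_scaleR mult.commute)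
    ultimately show ?thesis by simp
  qed
  then show ?thesis
    unfolding has_order_def by (intro exI eventually_mono[OF eventually_unit_at_right_0]) blast
qed

lemma psi_expansion:
  fixes A :: "real ^ 'n ^ 'n"
  shows "has_order m (\<lambda>h. psi p j ((c * h) *\<^sub>R A)
    - (\<Sum>i<m. h ^ i *\<^sub>R (c ^ i * (\<Sum>k=1..j. p j k / fact (i + k))) *\<^sub>R mpow A i))"
proof -
  have "has_order m (\<lambda>h. \<Sum>k=1..j. p j k *\<^sub>R (phi k (h *\<^sub>R c *\<^sub>R A)
      - (\<Sum>i<m. h ^ i *\<^sub>R (1 / fact (i + k)) *\<^sub>R mpow (c *\<^sub>R A) i)))"
    by (intro has_order_sum has_order_cscale phi_expansion)
  moreover have "(\<Sum>k=1..j. p j k *\<^sub>R (phi k (h *\<^sub>R c *\<^sub>R A)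
      - (\<Sum>i<m. h ^ i *\<^sub>R (1 / fact (i + k)) *\<^sub>R mpow (c *\<^sub>R A) i)))
    = psi p j ((c * h) *\<^sub>R A)
      - (\<Sum>i<m. h ^ i *\<^sub>R (c ^ i * (\<Sum>k=1..j. p j k / fact (i + k))) *\<^sub>R mpow A i)" for h
  proof -
    have "(\<Sum>k=1..j. p j k *\<^sub>R (\<Sum>i<m. h ^ i *\<^sub>R (1 / fact (i + k)) *\<^sub>R mpow (c *\<^sub>R A) i))
      = (\<Sum>i<m. \<Sum>k=1..j. (h ^ i * c ^ i * (p j k / fact (i + k))) *\<^sub>R mpow A i)"
      by (subst sum.swap) (simp add: scaleR_sum_right mpow_scaleR mult_ac)
    also have "\<dots> = (\<Sum>i<m. h ^ i *\<^sub>R (c ^ i * (\<Sum>k=1..j. p j k / fact (i + k))) *\<^sub>R mpow A i)"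
      by (simp add: scaleR_sum_left[symmetric] sum_distrib_left mult.assoc)
    finally show ?thesis
      by (simp add: psi_def scaleR_diff_right sum_subtractf mult.commute)
  qed
  ultimately show ?thesis by simp
qed

section \<open>The Krylov approximation of the Jacobian\<close>

lemma krylov_A_mult:
  "krylov_A J V *v x = (\<Sum>i<length V. (V ! i \<bullet> (J *v (\<Sum>j<length V. (V ! j \<bullet> x) *\<^sub>R V ! j))) *\<^sub>R V ! i)"
proof -
  have H: "V ! i \<bullet> (J *v (\<Sum>j<length V. (V ! j \<bullet> x) *\<^sub>R V ! j))
      = (\<Sum>j<length V. (V ! j \<bullet> x) * krylov_H J V i j)" for i
    by (simp add: linear_sum[OF matrix_vector_mul_linear] matrix_vector_mult_scaleR inner_sum_right krylov_H_def)
  have "(krylov_A J V *v x) $ r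
      = (\<Sum>i<length V. \<Sum>j<length V. V ! i $ r * krylov_H J V i j * (V ! j \<bullet> x))" for r
  proof -
    have "(krylov_A J V *v x) $ r
      = (\<Sum>s\<in>UNIV. \<Sum>i<length V. \<Sum>j<length V. V ! i $ r * krylov_H J V i j * (V ! j $ s * x $ s))"
      by (simp add: krylov_A_def matrix_vector_mult_def sum_distrib_right mult.assoc)
    also have "\<dots> = (\<Sum>i<length V. \<Sum>s\<in>UNIV. \<Sum>j<length V. V ! i $ r * krylov_H J V i j * (V ! j $ s * x $ s))"
      by (rule sum.swap)
    also have "\<dots> = (\<Sum>i<length V. \<Sum>j<length V. \<Sum>s\<in>UNIV. V ! i $ r * krylov_H J V i j * (V ! j $ s * x $ s))"
      by (intro sum.cong sum.swap refl)
    finally show ?thesis by (simp add: inner_vec_def sum_distrib_left)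
  qed
  then show ?thesis
    unfolding H by (simp add: vec_eq_iff sum_distrib_right sum_distrib_left mult_ac)
qed

lemma orthonormal_projection:
  assumes "orthonormal_basis_of S V" "x \<in> S"
  shows "(\<Sum>j<length V. (V ! j \<bullet> x) *\<^sub>R V ! j) = x"
proof -
  have "linear (\<lambda>x. \<Sum>j<length V. (V ! j \<bullet> x) *\<^sub>R V ! j)"
    by (intro linearI) (simp_all add: inner_add_right scaleR_add_left sum.distrib scaleR_sum_right)
  then show ?thesis
  proof (rule linear_eq_on_span[OF _ linear_ident])
    show "x \<in> span (set V)" using assms by (simp add: orthonormal_basis_of_def)
    fix v assume "v \<in> set V"
    then obtain k where k: "k < length V" "v = V ! k" by (auto simp: in_set_conv_nth)
    have "(\<Sum>j<length V. (V ! j \<bullet> v) *\<^sub>R V ! j) = (\<Sum>j<length V. if j = k then V ! j else 0)"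
      using assms(1) k by (intro sum.cong) (auto simp: orthonormal_basis_of_def)
    with k show "(\<Sum>j<length V. (V ! j \<bullet> v) *\<^sub>R V ! j) = v" by simp
  qed
qed

text \<open>\<open>A = P J P\<close> with \<open>P\<close> the orthogonal projection onto the Krylov space, and \<open>P\<close> fixes \<open>J\<^sup>i F\<close>
for \<open>i < M\<close>.\<close>
lemma krylov_powers_agree:
  assumes V: "orthonormal_basis_of (krylov_space M J F) V" and "i < M"
  shows "mpow (krylov_A J V) i *v F = mpow J i *v F"
  using assms(2)
proof (induction i)
  case (Suc i)
  have mem: "mpow J j *v F \<in> krylov_space M J F" if "j < M" for j
    unfolding krylov_space_def using that by (intro span_base) auto
  have "mpow (krylov_A J V) (Suc i) *v F = krylov_A J V *v (mpow J i *v F)"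
    using Suc by (simp add: matrix_vector_mul_assoc[symmetric])
  also have "\<dots> = (\<Sum>k<length V. (V ! k \<bullet> (J *v (mpow J i *v F))) *\<^sub>R V ! k)"
    unfolding krylov_A_mult using orthonormal_projection[OF V mem[of i]] Suc.prems by simp
  also have "J *v (mpow J i *v F) = mpow J (Suc i) *v F"
    by (simp add: matrix_vector_mul_assoc)
  also have "(\<Sum>k<length V. (V ! k \<bullet> (mpow J (Suc i) *v F)) *\<^sub>R V ! k) = mpow J (Suc i) *v F"
    by (rule orthonormal_projection[OF V mem[OF Suc.prems]])
  finally show ?case .
qed simp

section \<open>Expansion of the stages and the local error\<close>

lemma psi_1_flow_expansion:
  fixes A J :: "real ^ 'n ^ 'n"
  assumes agree: "\<And>i. i < 4 \<Longrightarrow> mpow A i *v F = mpow J i *v F"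
  shows "has_order 5 (\<lambda>h. psi p 1 ((c * h) *\<^sub>R A) *v (h *\<^sub>R F)
    - p 1 1 *\<^sub>R (h *\<^sub>R F + h ^ 2 *\<^sub>R (c / 2) *\<^sub>R (J *v F) + h ^ 3 *\<^sub>R (c ^ 2 / 6) *\<^sub>R (J *v (J *v F))
      + h ^ 4 *\<^sub>R (c ^ 3 / 24) *\<^sub>R (J *v (J *v (J *v F)))))"
proof -
  let ?S = "\<lambda>h. \<Sum>i<4. h ^ i *\<^sub>R (c ^ i * (\<Sum>k=1..1. p 1 k / fact (i + k))) *\<^sub>R mpow A i"
  have "has_order 5 (\<lambda>h. (psi p 1 ((c * h) *\<^sub>R A) - ?S h) *v (h *\<^sub>R F))"
    using has_order_bilinear[OF bounded_bilinear_matrix_vector_mult psi_expansion[of 4 p 1 c A]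
        has_order_monomial[of 1 F]]
    by simp
  moreover have "?S h *v (h *\<^sub>R F) = p 1 1 *\<^sub>R (h *\<^sub>R F + h ^ 2 *\<^sub>R (c / 2) *\<^sub>R (J *v F)
      + h ^ 3 *\<^sub>R (c ^ 2 / 6) *\<^sub>R (J *v (J *v F))
      + h ^ 4 *\<^sub>R (c ^ 3 / 24) *\<^sub>R (J *v (J *v (J *v F))))" for h
  proof -
    have "?S h *v (h *\<^sub>R F) = (\<Sum>i<4. (h ^ i *\<^sub>R (c ^ i * (p 1 1 / fact (i + 1))) *\<^sub>R mpow A i) *v (h *\<^sub>R F))"
      by (simp add: eval_nat_numeral matrix_vector_mult_add_rdistrib)
    also have "\<dots> = (\<Sum>i<4. (h ^ (i + 1) * c ^ i * (p 1 1 / fact (i + 1))) *\<^sub>R (mpow J i *v F))"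
      by (intro sum.cong refl)
        (simp add: agree matrix_vector_mult_scaleR scaleR_matrix_vector_assoc[symmetric] mult_ac)
    also have "\<dots> = p 1 1 *\<^sub>R (h *\<^sub>R F + h ^ 2 *\<^sub>R (c / 2) *\<^sub>R (J *v F)
      + h ^ 3 *\<^sub>R (c ^ 2 / 6) *\<^sub>R (J *v (J *v F))
      + h ^ 4 *\<^sub>R (c ^ 3 / 24) *\<^sub>R (J *v (J *v (J *v F))))"
      by (simp add: eval_nat_numeral matrix_vector_mul_assoc scaleR_add_right fact_numeral mult_ac)
    finally show ?thesis .
  qed
  ultimately show ?thesis by (simp add: matrix_vector_mult_diff_rdistrib)
qed

text \<open>The sums in \<open>s0\<close> and \<open>s1\<close> are the first two Taylor coefficients of \<open>\<psi>\<^sub>j\<close>. For the method, \<open>\<psi>\<^sub>2\<close> and \<open>\<psi>\<^sub>3\<close> are both \<open>\<phi>\<^sub>1 + \<phi>\<^sub>2\<close>, which has the values \<open>3/2\<close> and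
\<open>2/3\<close>.\<close>
lemma psi_quadratic_expansion:
  fixes A :: "real ^ 'n ^ 'n" and u :: "real \<Rightarrow> real ^ 'n"
  assumes u: "has_order 4 (\<lambda>h. u h - (h ^ 2 *\<^sub>R v + h ^ 3 *\<^sub>R w))"
    and s0: "(\<Sum>k=1..j. p j k / fact k) = 3 / 2"
    and s1: "(\<Sum>k=1..j. p j k / fact (1 + k)) = 2 / 3"
  shows "has_order 5 (\<lambda>h. psi p j ((c * h) *\<^sub>R A) *v (h *\<^sub>R u h)
    - (h ^ 3 *\<^sub>R (3 / 2) *\<^sub>R v + h ^ 4 *\<^sub>R ((3 / 2) *\<^sub>R w + (2 / 3 * c) *\<^sub>R (A *v v))))"
proof -
  let ?\<rho> = "\<lambda>h. u h - (h ^ 2 *\<^sub>R v + h ^ 3 *\<^sub>R w)"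
  let ?E = "\<lambda>h. psi p j ((c * h) *\<^sub>R A) - ((3 / 2) *\<^sub>R mat 1 + h *\<^sub>R (c * (2 / 3)) *\<^sub>R A)"
  have two: "sum t {..<2} = t 0 + t 1" for t :: "nat \<Rightarrow> real ^ 'n ^ 'n"
    by (simp add: eval_nat_numeral)
  have "mpow A 1 = A" by simp
  then have E: "has_order 2 ?E"
    using psi_expansion[of 2 p j c A]
    by (simp only: two add_0 power_0 mult_1 power_one_right s0 s1 mpow.simps(1) scaleR_one)
  have "has_order 3 (\<lambda>h. ?\<rho> h + h ^ 3 *\<^sub>R w)"
    by (intro has_order_add has_order_mono[OF u] has_order_monomial) simp
  then have u3: "has_order 3 (\<lambda>h. u h - h ^ 2 *\<^sub>R v)" by simp
  have "has_order 2 (\<lambda>h. (u h - h ^ 2 *\<^sub>R v) + h ^ 2 *\<^sub>R v)"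
    by (intro has_order_add has_order_mono[OF u3] has_order_monomial) simp
  then have u2: "has_order 2 u" by simp
  have "has_order 5 (\<lambda>h. ?E h *v (h *\<^sub>R u h))"
    using has_order_bilinear[OF bounded_bilinear_matrix_vector_mult E has_order_pscale[OF u2, of 1]] by simp
  moreover have "has_order 5 (\<lambda>h. h ^ 1 *\<^sub>R (3 / 2) *\<^sub>R ?\<rho> h)"
    using has_order_pscale[OF has_order_cscale[OF u, of "3 / 2"], of 1] by simp
  moreover have "has_order 5 (\<lambda>h. h ^ 2 *\<^sub>R (c * (2 / 3)) *\<^sub>R (A *v (u h - h ^ 2 *\<^sub>R v)))"
    using has_order_pscale[OF has_order_cscale[OF has_order_matrix[OF u3, of A], of "c * (2 / 3)"], of 2] by simp
  ultimately have "has_order 5 (\<lambda>h. ?E h *v (h *\<^sub>R u h) + h ^ 1 *\<^sub>R (3 / 2) *\<^sub>R ?\<rho> h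
      + h ^ 2 *\<^sub>R (c * (2 / 3)) *\<^sub>R (A *v (u h - h ^ 2 *\<^sub>R v)))"
    by (intro has_order_add)
  then show ?thesis
  proof (rule has_order_eq)
    fix h
    have "?E h *v (h *\<^sub>R u h) = psi p j ((c * h) *\<^sub>R A) *v (h *\<^sub>R u h)
        - ((3 / 2 * h) *\<^sub>R u h + (h * h * c * (2 / 3)) *\<^sub>R (A *v u h))"
      by (simp add: matrix_vector_mult_diff_rdistrib matrix_vector_mult_add_rdistrib
          matrix_vector_mult_scaleR scaleR_matrix_vector_assoc[symmetric] scaleR_diff_right
          scaleR_add_right mult_ac)
    then show "?E h *v (h *\<^sub>R u h) + h ^ 1 *\<^sub>R (3 / 2) *\<^sub>R ?\<rho> h
        + h ^ 2 *\<^sub>R (c * (2 / 3)) *\<^sub>R (A *v (u h - h ^ 2 *\<^sub>R v))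
      = psi p j ((c * h) *\<^sub>R A) *v (h *\<^sub>R u h)
        - (h ^ 3 *\<^sub>R (3 / 2) *\<^sub>R v + h ^ 4 *\<^sub>R ((3 / 2) *\<^sub>R w + (2 / 3 * c) *\<^sub>R (A *v v)))"
      by (simp add: matrix_vector_mult_diff_distrib matrix_vector_mult_scaleR
          eval_nat_numeral algebra_simps)
  qed
qed

text \<open>The remainder is \<open>N d + (J - A) d\<close>. Its linear part vanishes on \<open>F\<close> and \<open>J F\<close>, so it first shows at
\<open>h\<^sup>3\<close>, through the coefficient \<open>w\<close> of \<open>d\<close>.\<close>
lemma remainder_expansion:
  fixes f :: "real ^ 'n \<Rightarrow> real ^ 'n" and A J :: "real ^ 'n ^ 'n"
  assumes N3: "\<And>d. has_order 3 (\<lambda>h. d h - (h *\<^sub>R c *\<^sub>R F + h ^ 2 *\<^sub>R (c ^ 2 / 2) *\<^sub>R (J *v F))) \<Longrightarrow>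
       has_order 4 (\<lambda>h. (f (x + d h) - f x - J *v d h) - (h ^ 2 *\<^sub>R c ^ 2 *\<^sub>R q2 + h ^ 3 *\<^sub>R c ^ 3 *\<^sub>R q3))"
    and A: "A *v F = J *v F" "A *v (J *v F) = J *v (J *v F)"
    and d: "has_order 4 (\<lambda>h. d h - (h *\<^sub>R c *\<^sub>R F + h ^ 2 *\<^sub>R (c ^ 2 / 2) *\<^sub>R (J *v F) + h ^ 3 *\<^sub>R w))"
  shows "has_order 4 (\<lambda>h. remainder f A x (x + d h)
    - (h ^ 2 *\<^sub>R c ^ 2 *\<^sub>R q2 + h ^ 3 *\<^sub>R (c ^ 3 *\<^sub>R q3 + (J *v w - A *v w))))"
proof -
  let ?\<rho> = "\<lambda>h. d h - (h *\<^sub>R c *\<^sub>R F + h ^ 2 *\<^sub>R (c ^ 2 / 2) *\<^sub>R (J *v F) + h ^ 3 *\<^sub>R w)"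
  have "has_order 3 (\<lambda>h. ?\<rho> h + h ^ 3 *\<^sub>R w)"
    by (intro has_order_add has_order_mono[OF d] has_order_monomial) simp
  then have "has_order 3 (\<lambda>h. d h - (h *\<^sub>R c *\<^sub>R F + h ^ 2 *\<^sub>R (c ^ 2 / 2) *\<^sub>R (J *v F)))"
    by (simp add: diff_diff_eq[symmetric])
  from has_order_add[OF N3[OF this] has_order_diff[OF has_order_matrix[OF d, of J] has_order_matrix[OF d, of A]]]
  show ?thesis
    by (simp add: remainder_def A matrix_vector_mult_diff_distrib matrix_vector_right_distrib
        matrix_vector_mult_scaleR scaleR_add_right scaleR_diff_right algebra_simps)
qed

theorem mainTheorem3:
  fixes f :: "real ^ 'n \<Rightarrow> real ^ 'n" and yn :: "real ^ 'n" and y :: "real \<Rightarrow> real ^ 'n"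
    and tn T :: real and M :: nat and V :: "(real ^ 'n) list"
    and a g p :: "nat \<Rightarrow> nat \<Rightarrow> real" and b bhat :: "nat \<Rightarrow> real"
  assumes a: "a 1 1 = sqrt 3 / 2" "a 2 1 = sqrt 3 / 2" "a 2 2 = 3 / 4"
    and b: "b 1 = 2 / sqrt 3" "b 2 = 352 / 729" "b 3 = 64 / 729"
    and g: "g 1 1 = 3 / 4" "g 2 1 = 3 / 4" "g 2 2 = 0"
           "g 3 1 = 1" "g 3 2 = 9 / 16" "g 3 3 = 9 / 16"
    and p: "p 1 1 = sqrt 3 / 2" "p 2 1 = 1" "p 2 2 = 1" "p 3 1 = 1" "p 3 2 = 1" "p 3 3 = 0"
    and bhat: "bhat 1 = 2 / sqrt 3" "bhat 2 = 32 / 81" "bhat 3 = 0"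
    and M: "M \<ge> 4"
    and f: "smooth f"
    and V: "orthonormal_basis_of (krylov_space M (jacobian f (at yn)) (f yn)) V"
    and T: "T > 0"
    and ode: "\<And>t. t \<in> {tn..tn + T} \<Longrightarrow>
               (y has_vector_derivative f (y t)) (at t within {tn..tn + T})"
    and init: "y tn = yn"
  shows "(\<lambda>h. norm (epirkK_step f V a g p b yn h - y (tn + h))) \<in> O[at_right 0](\<lambda>h. h ^ 5) \<and>
         (\<lambda>h. norm (epirkK_step f V a g p bhat yn h - y (tn + h))) \<in> O[at_right 0](\<lambda>h. h ^ 4)"
proof -
  define J where "J = jacobian f (at yn)"
  define A where "A = krylov_A J V"
  define F where "F = f yn"
  define N where "N d = f (yn + d) - f yn - J *v d" for d
  note M_simps = matrix_vector_right_distrib matrix_vector_mult_diff_distrib matrix_vector_mult_scaleR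

  have "C_diff 1 f" using f by (simp only: smooth_def)
  then have diff: "f differentiable (at yn)" by simp
  then have "(f has_derivative (\<lambda>d. J *v d)) (at yn)"
    unfolding J_def by (simp add: jacobian_works)
  then have fd: "frechet_derivative f (at yn) = (\<lambda>d. J *v d)"
    by (rule frechet_derivative_at[symmetric])
  obtain q2 q3 where
    N1: "\<And>d. has_order 1 d \<Longrightarrow> has_order 2 (\<lambda>h. N (d h))" and
    N2: "\<And>d c. has_order 2 (\<lambda>h. d h - h *\<^sub>R c *\<^sub>R F) \<Longrightarrow> has_order 3 (\<lambda>h. N (d h) - h ^ 2 *\<^sub>R c ^ 2 *\<^sub>R q2)" and
    N3: "\<And>d c. has_order 3 (\<lambda>h. d h - (h *\<^sub>R c *\<^sub>R F + h ^ 2 *\<^sub>R (c ^ 2 / 2) *\<^sub>R (J *v F))) \<Longrightarrow>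
       has_order 4 (\<lambda>h. N (d h) - (h ^ 2 *\<^sub>R c ^ 2 *\<^sub>R q2 + h ^ 3 *\<^sub>R c ^ 3 *\<^sub>R q3))"
    using nonlinear_part_expansion[OF f, of yn F "J *v F"] unfolding fd N_def by blast

  define e where "e h = y (tn + h) - yn" for h
  have exact: "has_order 5 (\<lambda>h. e h - (h *\<^sub>R F + h ^ 2 *\<^sub>R (1/2) *\<^sub>R (J *v F)
    + h ^ 3 *\<^sub>R ((1/6) *\<^sub>R (J *v (J *v F)) + (1/3) *\<^sub>R q2)
    + h ^ 4 *\<^sub>R ((1/24) *\<^sub>R (J *v (J *v (J *v F))) + (1/12) *\<^sub>R (J *v q2) + (1/4) *\<^sub>R q3)))"
  proof (rule exact_solution_expansion[OF T _ _ _ N1 N2 N3])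
    show "e 0 = 0" "N 0 = 0" by (simp_all add: e_def N_def init)
    fix t assume t: "t \<in> {0..T}"
    have "((\<lambda>t. tn + t) has_vector_derivative 1) (at t within {0..T})"
      by (auto intro!: derivative_eq_intros)
    moreover have "(y has_vector_derivative f (y (tn + t))) (at (tn + t) within (\<lambda>t. tn + t) ` {0..T})"
      using ode[of "tn + t"] t by (simp add: add.commute)
    ultimately have "((\<lambda>t. y (tn + t)) has_vector_derivative f (y (tn + t))) (at t within {0..T})"
      using vector_diff_chain_within[of "\<lambda>t. tn + t" 1 t "{0..T}" y] by (simp add: o_def)
    moreover have "F + J *v e t + N (e t) = f (y (tn + t)) - 0"
      by (simp add: F_def N_def e_def)
    ultimately show "(e has_vector_derivative F + J *v e t + N (e t)) (at t within {0..T})"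
      unfolding e_def by (auto intro!: derivative_eq_intros)
  qed

  have agree: "mpow A i *v F = mpow J i *v F" if "i < 4" for i
    unfolding A_def using V M that by (intro krylov_powers_agree[of M]) (auto simp: J_def F_def)
  have AF: "A *v F = J *v F" "A *v (J *v F) = J *v (J *v F)"
    "A *v (J *v (J *v F)) = J *v (J *v (J *v F))"
    using agree[of 1] agree[of 2] agree[of 3]
    by (simp_all add: eval_nat_numeral matrix_vector_mul_assoc[symmetric])

  \<comment> \<open>Displacements of the stages from \<open>yn\<close>, and the remainders there. The second stage reuses
    the exponential term of the first, because \<open>a\<close> and \<open>g\<close> have equal entries in it, and its
    other matrix argument is \<open>0\<close>.\<close>
  define d1 where "d1 h = a 1 1 *\<^sub>R (psi p 1 ((3 / 4 * h) *\<^sub>R A) *v (h *\<^sub>R F))" for h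
  define r1 where "r1 h = remainder f A yn (yn + d1 h)" for h
  define d2 where "d2 h = d1 h + (3 / 4) *\<^sub>R (psi p 2 ((0 * h) *\<^sub>R A) *v (h *\<^sub>R r1 h))" for h
  define r2 where "r2 h = remainder f A yn (yn + d2 h)" for h
  have step: "epirkK_step f V a g p \<beta> yn h = yn
      + \<beta> 1 *\<^sub>R (psi p 1 ((1 * h) *\<^sub>R A) *v (h *\<^sub>R F))
      + \<beta> 2 *\<^sub>R (psi p 2 ((9 / 16 * h) *\<^sub>R A) *v (h *\<^sub>R r1 h))
      + \<beta> 3 *\<^sub>R (psi p 3 ((9 / 16 * h) *\<^sub>R A) *v (h *\<^sub>R (r2 h - 2 *\<^sub>R r1 h)))" for \<beta> h
  proof -
    let ?Y1 = "epirk_Y1 f A a g p yn h" and ?Y2 = "epirk_Y2 f A a g p yn h"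
    have r0: "remainder f A yn yn = 0" by (simp add: remainder_def)
    have Y1: "?Y1 = yn + d1 h" by (simp only: epirk_Y1_def d1_def g F_def)
    have \<Delta>1: "fdiff 1 (remainder f A yn) (yn # ?Y1 # Ys) 0 = r1 h" for Ys
      by (simp add: Y1 r0 r1_def)
    have Y2: "?Y2 = yn + d2 h"
      by (simp only: epirk_Y2_def Let_def \<Delta>1 d2_def d1_def g a F_def add.assoc)
    have \<Delta>2: "fdiff 2 (remainder f A yn) [yn, ?Y1, ?Y2] 0 = r2 h - 2 *\<^sub>R r1 h"
      by (simp add: eval_nat_numeral Y1 Y2 r0 r1_def r2_def scaleR_2)
    show ?thesis
      unfolding epirkK_step_def J_def[symmetric] A_def[symmetric] epirk_step_def Let_def \<Delta>1 \<Delta>2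
      by (simp only: g F_def)
  qed

  have sums: "sum t {1..2} = t 1 + t 2" "sum t {1..3} = t 1 + t 2 + t 3" for t :: "nat \<Rightarrow> real"
    by (simp_all add: eval_nat_numeral)
  have psi_2: "(\<Sum>k=1..2. p 2 k / fact k) = 3 / 2" "(\<Sum>k=1..2. p 2 k / fact (1 + k)) = 2 / 3"
    unfolding sums p by (simp_all add: fact_numeral)
  have psi_3: "(\<Sum>k=1..3. p 3 k / fact k) = 3 / 2" "(\<Sum>k=1..3. p 3 k / fact (1 + k)) = 2 / 3"
    unfolding sums p by (simp_all add: fact_numeral)
  have psi_1: "has_order 5 (\<lambda>h. \<beta> *\<^sub>R (psi p 1 ((c * h) *\<^sub>R A) *v (h *\<^sub>R F))
      - (\<beta> * p 1 1) *\<^sub>R (h *\<^sub>R F + h ^ 2 *\<^sub>R (c / 2) *\<^sub>R (J *v F)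
        + h ^ 3 *\<^sub>R (c ^ 2 / 6) *\<^sub>R (J *v (J *v F))
        + h ^ 4 *\<^sub>R (c ^ 3 / 24) *\<^sub>R (J *v (J *v (J *v F)))))" for \<beta> c
    by (rule has_order_eq[OF has_order_cscale[OF psi_1_flow_expansion[OF agree]]])
      (simp_all add: scaleR_diff_right)

  have a11: "a 1 1 * p 1 1 = 3 / 4" unfolding a p by simp
  \<comment> \<open>The coefficient of \<open>h\<^sup>3\<close> in \<open>d1\<close>. Since \<open>J\<^sup>3 F\<close> is still
    in the Krylov space, \<open>J - A\<close> annihilates it.\<close>
  define w where "w = (9 / 128) *\<^sub>R (J *v (J *v F))"
  have Jw: "J *v w = A *v w" by (simp add: w_def M_simps AF)
  have d1: "has_order 4 (\<lambda>h. d1 h - (h *\<^sub>R (3/4) *\<^sub>R F + h ^ 2 *\<^sub>R ((3/4) ^ 2 / 2) *\<^sub>R (J *v F) + h ^ 3 *\<^sub>R w))"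
  proof (rule has_order_eq)
    \<comment> \<open>The last summand is the \<open>h\<^sup>4\<close> term of the expansion of \<open>d1\<close>, returned to the error.\<close>
    show "has_order 4 (\<lambda>h. (a 1 1 *\<^sub>R (psi p 1 ((3 / 4 * h) *\<^sub>R A) *v (h *\<^sub>R F))
      - (a 1 1 * p 1 1) *\<^sub>R (h *\<^sub>R F + h ^ 2 *\<^sub>R (3 / 4 / 2) *\<^sub>R (J *v F)
        + h ^ 3 *\<^sub>R ((3 / 4) ^ 2 / 6) *\<^sub>R (J *v (J *v F))
        + h ^ 4 *\<^sub>R ((3 / 4) ^ 3 / 24) *\<^sub>R (J *v (J *v (J *v F)))))
      + h ^ 4 *\<^sub>R (27 / 2048) *\<^sub>R (J *v (J *v (J *v F))))"
      by (intro has_order_add has_order_mono[OF psi_1] has_order_monomial) simp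
  qed (unfold a11, simp add: d1_def w_def power_divide scaleR_add_right mult.commute)
  have r1: "has_order 4 (\<lambda>h. r1 h - (h ^ 2 *\<^sub>R (9/16) *\<^sub>R q2 + h ^ 3 *\<^sub>R (27/64) *\<^sub>R q3))"
    using remainder_expansion[OF N3[unfolded N_def] AF(1,2) d1] Jw
    by (simp add: r1_def power_divide)
  have d2: "has_order 4 (\<lambda>h. d2 h - (h *\<^sub>R (3/4) *\<^sub>R F + h ^ 2 *\<^sub>R ((3/4) ^ 2 / 2) *\<^sub>R (J *v F)
      + h ^ 3 *\<^sub>R (w + (81/128) *\<^sub>R q2)))"
  proof (rule has_order_eq)
    \<comment> \<open>\<open>?z\<close> is the \<open>h\<^sup>4\<close> coefficient supplied by \<open>psi_quadratic_expansion\<close>.\<close>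
    let ?z = "(3 / 2) *\<^sub>R (27 / 64) *\<^sub>R q3 + (2 / 3 * 0) *\<^sub>R (A *v ((9 / 16) *\<^sub>R q2))"
    show "has_order 4 (\<lambda>h. (d1 h - (h *\<^sub>R (3/4) *\<^sub>R F + h ^ 2 *\<^sub>R ((3/4) ^ 2 / 2) *\<^sub>R (J *v F) + h ^ 3 *\<^sub>R w))
      + (3 / 4) *\<^sub>R ((psi p 2 ((0 * h) *\<^sub>R A) *v (h *\<^sub>R r1 h)
        - (h ^ 3 *\<^sub>R (3 / 2) *\<^sub>R (9/16) *\<^sub>R q2 + h ^ 4 *\<^sub>R ?z)) + h ^ 4 *\<^sub>R ?z))"
      by (intro has_order_add has_order_cscale d1 has_order_monomial
          has_order_mono[OF psi_quadratic_expansion[where p = p and j = 2, OF r1 psi_2]]) simp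
  qed (simp add: d2_def algebra_simps)
  have r2: "has_order 4 (\<lambda>h. r2 h - (h ^ 2 *\<^sub>R (9/16) *\<^sub>R q2
      + h ^ 3 *\<^sub>R ((27/64) *\<^sub>R q3 + (81/128) *\<^sub>R (J *v q2 - A *v q2))))"
    using remainder_expansion[OF N3[unfolded N_def] AF(1,2) d2] Jw
    by (simp add: r2_def power_divide M_simps scaleR_diff_right)
  have r12: "has_order 4 (\<lambda>h. (r2 h - 2 *\<^sub>R r1 h) - (h ^ 2 *\<^sub>R (-9/16) *\<^sub>R q2
      + h ^ 3 *\<^sub>R ((-27/64) *\<^sub>R q3 + (81/128) *\<^sub>R (J *v q2 - A *v q2))))"
    by (rule has_order_eq[OF has_order_diff[OF r2 has_order_cscale[OF r1, of 2]]]) (simp add: vec_eq_iff algebra_simps)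

  \<comment> \<open>The local error for general weights: the order conditions say that these four coefficients
    vanish.\<close>
  have local_error: "has_order 5 (\<lambda>h. (epirkK_step f V a g p \<beta> yn h - y (tn + h))
      - (h ^ 3 *\<^sub>R ((27/32) * (\<beta> 2 - \<beta> 3) - 1/3) *\<^sub>R q2
       + h ^ 4 *\<^sub>R ((81/128 * (\<beta> 2 - \<beta> 3) - 1/4) *\<^sub>R q3 + ((243/256) * \<beta> 3 - 1/12) *\<^sub>R (J *v q2)
          + ((27/128) * (\<beta> 2 - \<beta> 3) - 243/256 * \<beta> 3) *\<^sub>R (A *v q2))))"
    if "\<beta> 1 = 2 / sqrt 3" for \<beta>
  proof (rule has_order_eq)
    have b1: "\<beta> 1 * p 1 1 = 1" unfolding that p by simp
    let ?v2 = "(9/16) *\<^sub>R q2" and ?w2 = "(27/64) *\<^sub>R q3"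
    let ?v3 = "(-9/16) *\<^sub>R q2" and ?w3 = "(-27/64) *\<^sub>R q3 + (81/128) *\<^sub>R (J *v q2 - A *v q2)"
    let ?S1 = "\<lambda>h. \<beta> 1 *\<^sub>R (psi p 1 ((1 * h) *\<^sub>R A) *v (h *\<^sub>R F))
      - (\<beta> 1 * p 1 1) *\<^sub>R (h *\<^sub>R F + h ^ 2 *\<^sub>R (1 / 2) *\<^sub>R (J *v F)
        + h ^ 3 *\<^sub>R (1 ^ 2 / 6) *\<^sub>R (J *v (J *v F))
        + h ^ 4 *\<^sub>R (1 ^ 3 / 24) *\<^sub>R (J *v (J *v (J *v F))))"
    let ?S2 = "\<lambda>h. psi p 2 ((9 / 16 * h) *\<^sub>R A) *v (h *\<^sub>R r1 h)
      - (h ^ 3 *\<^sub>R (3 / 2) *\<^sub>R ?v2 + h ^ 4 *\<^sub>R ((3 / 2) *\<^sub>R ?w2 + (2 / 3 * (9 / 16)) *\<^sub>R (A *v ?v2)))"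
    let ?S3 = "\<lambda>h. psi p 3 ((9 / 16 * h) *\<^sub>R A) *v (h *\<^sub>R (r2 h - 2 *\<^sub>R r1 h))
      - (h ^ 3 *\<^sub>R (3 / 2) *\<^sub>R ?v3 + h ^ 4 *\<^sub>R ((3 / 2) *\<^sub>R ?w3 + (2 / 3 * (9 / 16)) *\<^sub>R (A *v ?v3)))"
    let ?E = "\<lambda>h. e h - (h *\<^sub>R F + h ^ 2 *\<^sub>R (1/2) *\<^sub>R (J *v F)
      + h ^ 3 *\<^sub>R ((1/6) *\<^sub>R (J *v (J *v F)) + (1/3) *\<^sub>R q2)
      + h ^ 4 *\<^sub>R ((1/24) *\<^sub>R (J *v (J *v (J *v F))) + (1/12) *\<^sub>R (J *v q2) + (1/4) *\<^sub>R q3))"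
    show "has_order 5 (\<lambda>h. ?S1 h + \<beta> 2 *\<^sub>R ?S2 h + \<beta> 3 *\<^sub>R ?S3 h - ?E h)"
      by (intro has_order_add has_order_diff has_order_cscale psi_1 exact
          psi_quadratic_expansion[where p = p and j = 2, OF r1 psi_2]
          psi_quadratic_expansion[where p = p and j = 3, OF r12 psi_3])
    show "?S1 h + \<beta> 2 *\<^sub>R ?S2 h + \<beta> 3 *\<^sub>R ?S3 h - ?E h = (epirkK_step f V a g p \<beta> yn h - y (tn + h))
      - (h ^ 3 *\<^sub>R ((27/32) * (\<beta> 2 - \<beta> 3) - 1/3) *\<^sub>R q2
       + h ^ 4 *\<^sub>R ((81/128 * (\<beta> 2 - \<beta> 3) - 1/4) *\<^sub>R q3 + ((243/256) * \<beta> 3 - 1/12) *\<^sub>R (J *v q2)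
          + ((27/128) * (\<beta> 2 - \<beta> 3) - 243/256 * \<beta> 3) *\<^sub>R (A *v q2)))" for h
      unfolding step b1 e_def
      by (simp add: M_simps linear_neg[OF matrix_vector_mul_linear] vec_eq_iff algebra_simps
          diff_divide_distrib add_divide_distrib)
  qed

  show ?thesis
  proof (intro conjI has_order_bigo)
    show "has_order 5 (\<lambda>h. epirkK_step f V a g p b yn h - y (tn + h))"
      by (rule has_order_eq[OF local_error[where \<beta> = b, OF b(1)]]) (simp_all add: b)
    have "has_order 4 (\<lambda>h. (epirkK_step f V a g p bhat yn h - y (tn + h))
      - h ^ 4 *\<^sub>R ((-1/12) *\<^sub>R (J *v q2) + (1/12) *\<^sub>R (A *v q2)))"
      by (rule has_order_mono[OF has_order_eq[OF local_error[where \<beta> = bhat, OF bhat(1)]]]) (simp_all add: bhat)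
    from has_order_add[OF this has_order_monomial[of 4 "(-1/12) *\<^sub>R (J *v q2) + (1/12) *\<^sub>R (A *v q2)"]]
    show "has_order 4 (\<lambda>h. epirkK_step f V a g p bhat yn h - y (tn + h))" by simp
  qed
qed

end
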